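(* For every integer $d\ge 1$ there exists a closed shift-invariant subset $X\subseteq\{0,1\}^{\mathbb{Z}^d}$ such that the $\mathbb{Z}^d$-shift action on $X$ is chaotic almost minimal (CAM) and supports at least two distinct nonatomic ergodic invariant Borel probability measures.
   Context: Let $G$ be a countable discrete group. A topological $G$-system $(X,T)$ consists of a compact metric space $X$ and an action $T\colon G\to\mathrm{Homeo}(X)$, $g\mapsto T_g$. The system is topologically transitive if for all nonempty open $U,V\subseteq X$ there is $g\in G$ with $T_gU\cap V\neq\emptyset$; the action is faithful if $T_g=\mathrm{id}_X$ only when $g$ is the identity. A point is periodic if its $G$-orbit is finite. The system is chaotic almost minimal (CAM) if: (1) it is topologically transitive and the action is faithful; (2) the periodic points are dense in $X$; (3) every proper closed $T$-invariant subset of $X$ is finite. The $\mathbb{Z}^d$-shift on $\{0,1\}^{\mathbb{Z}^d}$ (product topology) is $(\sigma_v x)(u)=x(u+v)$ for $u,v\in\mathbb{Z}^d$. *)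

theory Defs
  imports "HOL-Probability.Probability"
begin

text \<open>The lattice Z^d is modelled as functions 'n \<Rightarrow> int for a finite index type 'n
  with CARD('n) = d. Configurations are maps ('n \<Rightarrow> int) \<Rightarrow> nat with values in {0,1}.\<close>

definition full_shift_space :: "((('n::finite) \<Rightarrow> int) \<Rightarrow> nat) topology" where
  "full_shift_space = product_topology (\<lambda>_. discrete_topology {0,1}) UNIV"

definition zd_shift :: "(('n::finite) \<Rightarrow> int) \<Rightarrow> (('n \<Rightarrow> int) \<Rightarrow> nat) \<Rightarrow> (('n \<Rightarrow> int) \<Rightarrow> nat)" where
  "zd_shift v x = (\<lambda>u. x (\<lambda>i. u i + v i))"

definition shift_invariant :: "((('n::finite) \<Rightarrow> int) \<Rightarrow> nat) set \<Rightarrow> bool" where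
  "shift_invariant Y \<longleftrightarrow> (\<forall>v. zd_shift v ` Y \<subseteq> Y)"

definition subshift :: "((('n::finite) \<Rightarrow> int) \<Rightarrow> nat) set \<Rightarrow> bool" where
  "subshift X \<longleftrightarrow> closedin full_shift_space X \<and> shift_invariant X"

definition topologically_transitive :: "((('n::finite) \<Rightarrow> int) \<Rightarrow> nat) set \<Rightarrow> bool" where
  "topologically_transitive X \<longleftrightarrow>
     (\<forall>U V. openin (subtopology full_shift_space X) U \<and> U \<noteq> {} \<and>
            openin (subtopology full_shift_space X) V \<and> V \<noteq> {} \<longrightarrow>
            (\<exists>g. zd_shift g ` U \<inter> V \<noteq> {}))"

definition faithful_action :: "((('n::finite) \<Rightarrow> int) \<Rightarrow> nat) set \<Rightarrow> bool" where
  "faithful_action X \<longleftrightarrow> (\<forall>g. (\<forall>x\<in>X. zd_shift g x = x) \<longrightarrow> g = (\<lambda>_. 0))"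

definition periodic_point :: "((('n::finite) \<Rightarrow> int) \<Rightarrow> nat) \<Rightarrow> bool" where
  "periodic_point x \<longleftrightarrow> finite (range (\<lambda>g. zd_shift g x))"

definition chaotic_almost_minimal :: "((('n::finite) \<Rightarrow> int) \<Rightarrow> nat) set \<Rightarrow> bool" where
  "chaotic_almost_minimal X \<longleftrightarrow>
     topologically_transitive X \<and> faithful_action X \<and>
     (subtopology full_shift_space X) closure_of {x\<in>X. periodic_point x} = X \<and>
     (\<forall>Y. Y \<subseteq> X \<and> Y \<noteq> X \<and> closedin (subtopology full_shift_space X) Y \<and>
          shift_invariant Y \<longrightarrow> finite Y)"

definition borel_sets_of :: "'a topology \<Rightarrow> 'a set set" where
  "borel_sets_of T = sigma_sets (topspace T) {U. openin T U}"

definition borel_prob_on :: "((('n::finite) \<Rightarrow> int) \<Rightarrow> nat) set \<Rightarrow> ((('n \<Rightarrow> int) \<Rightarrow> nat)) measure \<Rightarrow> bool" where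
  "borel_prob_on X M \<longleftrightarrow> prob_space M \<and> space M = X \<and>
     sets M = borel_sets_of (subtopology full_shift_space X)"

definition shift_invariant_measure :: "((('n::finite) \<Rightarrow> int) \<Rightarrow> nat) set \<Rightarrow> ((('n \<Rightarrow> int) \<Rightarrow> nat)) measure \<Rightarrow> bool" where
  "shift_invariant_measure X M \<longleftrightarrow> borel_prob_on X M \<and>
     (\<forall>g. \<forall>A\<in>sets M. emeasure M (zd_shift g -` A \<inter> X) = emeasure M A)"

definition ergodic_measure :: "((('n::finite) \<Rightarrow> int) \<Rightarrow> nat) set \<Rightarrow> ((('n \<Rightarrow> int) \<Rightarrow> nat)) measure \<Rightarrow> bool" where
  "ergodic_measure X M \<longleftrightarrow> shift_invariant_measure X M \<and>
     (\<forall>A\<in>sets M. (\<forall>g. zd_shift g -` A \<inter> X = A) \<longrightarrow> emeasure M A = 0 \<or> emeasure M A = 1)"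

definition nonatomic_measure :: "'a measure \<Rightarrow> bool" where
  "nonatomic_measure M \<longleftrightarrow> (\<forall>x\<in>space M. emeasure M {x} = 0)"

end

theory Submission
  imports Defs
begin

text \<open>
  Fix side lengths \<open>L n\<close> with \<open>L (n + 1) = q n * L n\<close> and \<open>q n\<close> growing fast. For \<open>a = 0, 1\<close> build
  \<open>L n\<close>-periodic configurations \<open>per n a\<close>: an \<open>L (n + 1)\<close>-block of \<open>per (n + 1) a\<close> is made of
  \<open>L n\<close>-blocks of \<open>per n a\<close>, except for a few isolated interior cells, one of which carries \<open>per n 1\<close>
  while the others carry the old periodic patterns \<open>per k 0\<close>, \<open>k < n\<close>. The system \<open>X\<close> is the closure
  of the orbits of all \<open>per n 0\<close>. Every pattern of \<open>X\<close> occurs in both \<open>per m 0\<close> and \<open>per m 1\<close> for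
  large \<open>m\<close>, so a point avoiding it only sees old patterns \<open>per k 0\<close> with \<open>k < m\<close>; since different old
  patterns are never adjacent, such a point is one of finitely many periodic ones.

  The two measures are images of Haar measure on the \<open>d\<close>-dimensional odometer. An odometer point picks
  a position \<open>pos n\<close> in the \<open>L n\<close>-block for every \<open>n\<close>, and almost surely (Borel--Cantelli) the
  configurations \<open>per n a\<close> seen from these positions converge; the limits for \<open>a = 0\<close> and \<open>a = 1\<close> are
  equivariant and have different densities of ones.
\<close>

section \<open>Windows and the product topology\<close>

definition vadd :: "('n \<Rightarrow> int) \<Rightarrow> ('n \<Rightarrow> int) \<Rightarrow> 'n \<Rightarrow> int" (infixl "\<boxplus>" 65)
  where "u \<boxplus> v = (\<lambda>i. u i + v i)"

definition vminus :: "('n \<Rightarrow> int) \<Rightarrow> ('n \<Rightarrow> int) \<Rightarrow> 'n \<Rightarrow> int" (infixl "\<boxminus>" 65)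
  where "u \<boxminus> v = (\<lambda>i. u i - v i)"

lemma vadd_apply: "(u \<boxplus> v) i = u i + v i"
  by (simp add: vadd_def)

lemma vminus_apply: "(u \<boxminus> v) i = u i - v i"
  by (simp add: vminus_def)

lemma vadd_assoc: "u \<boxplus> v \<boxplus> w = u \<boxplus> (v \<boxplus> w)"
  by (simp add: fun_eq_iff vadd_apply)

lemma vadd_vminus [simp]: "v \<boxplus> (u \<boxminus> v) = u" "u \<boxminus> v \<boxplus> v = u"
  by (simp_all add: fun_eq_iff vadd_apply vminus_apply)

lemma vadd_zero [simp]: "(\<lambda>_. 0) \<boxplus> u = u" "u \<boxplus> (\<lambda>_. 0) = u"
  by (simp_all add: fun_eq_iff vadd_apply vminus_apply)

definition window :: "nat \<Rightarrow> ('n \<Rightarrow> int) set" where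
  "window R = {u. \<forall>i. \<bar>u i\<bar> \<le> int R}"

lemma window_mono: "R \<le> R' \<Longrightarrow> window R \<subseteq> window R'"
  unfolding window_def by (auto intro: order_trans)

lemma finite_int_box: "finite {u :: 'n::finite \<Rightarrow> int. \<forall>i. a \<le> u i \<and> u i < b}"
proof -
  have "{u :: 'n \<Rightarrow> int. \<forall>i. a \<le> u i \<and> u i < b} = (\<Pi>\<^sub>E i\<in>UNIV. {a..<b})"
    by (auto simp: PiE_def Pi_def)
  then show ?thesis by (simp add: finite_PiE)
qed

lemma finite_window: "finite (window R :: ('n::finite \<Rightarrow> int) set)"
  by (rule finite_subset[OF _ finite_int_box[of "- int R" "int R + 1"]]) (auto simp: window_def abs_le_iff zle_add1_eq_le minus_le_iff)

lemma finite_subset_window: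
  assumes "finite (F :: ('n::finite \<Rightarrow> int) set)"
  shows "\<exists>R. F \<subseteq> window R"
  using assms
proof induction
  case (insert u F)
  then obtain R where R: "F \<subseteq> window R" by auto
  have "u \<in> window (nat (Max (range (\<lambda>i. \<bar>u i\<bar>))))"
    unfolding window_def
  proof (intro CollectI allI)
    fix i
    have "\<bar>u i\<bar> \<le> Max (range (\<lambda>i. \<bar>u i\<bar>))" by (intro Max_ge) auto
    then show "\<bar>u i\<bar> \<le> int (nat (Max (range (\<lambda>i. \<bar>u i\<bar>))))" by linarith
  qed
  then show ?case
    using R window_mono[of R "max R (nat (Max (range (\<lambda>i. \<bar>u i\<bar>))))"]
      window_mono[of "nat (Max (range (\<lambda>i. \<bar>u i\<bar>)))" "max R (nat (Max (range (\<lambda>i. \<bar>u i\<bar>))))"]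
    by (intro exI[of _ "max R (nat (Max (range (\<lambda>i. \<bar>u i\<bar>))))"]) auto
qed simp

lemma topspace_full_shift: "topspace (full_shift_space :: (('n::finite \<Rightarrow> int) \<Rightarrow> nat) topology) = {x. \<forall>u. x u \<le> 1}"
  by (auto simp: full_shift_space_def PiE_def Pi_def le_Suc_eq)

text \<open>A basic open set of the product restricts only finitely many coordinates, and every
  finite set of coordinates lies in a window. So windows give a neighbourhood base, and the later
  arguments work with them directly.\<close>

lemma openin_full_shift:
  fixes U :: "(('n::finite \<Rightarrow> int) \<Rightarrow> nat) set"
  shows "openin full_shift_space U \<longleftrightarrow> U \<subseteq> {x. \<forall>u. x u \<le> 1} \<and>
    (\<forall>x\<in>U. \<exists>R. \<forall>y. (\<forall>u. y u \<le> 1) \<longrightarrow> (\<forall>u\<in>window R. y u = x u) \<longrightarrow> y \<in> U)"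
proof
  assume U: "openin full_shift_space U"
  have "\<exists>R. \<forall>y. (\<forall>u. y u \<le> 1) \<longrightarrow> (\<forall>u\<in>window R. y u = x u) \<longrightarrow> y \<in> U" if x: "x \<in> U" for x
  proof -
    obtain V where V: "finite {u. V u \<noteq> {0, 1::nat}}" "x \<in> Pi\<^sub>E UNIV V" "Pi\<^sub>E UNIV V \<subseteq> U"
      using U x by (auto simp: full_shift_space_def openin_product_topology_alt)
    obtain R where R: "{u. V u \<noteq> {0, 1::nat}} \<subseteq> window R" using finite_subset_window[OF V(1)] by auto
    have "y \<in> U" if y: "\<forall>u. y u \<le> 1" "\<forall>u\<in>window R. y u = x u" for y
    proof -
      have "y u \<in> V u" for u
      proof (cases "V u = {0, 1}")
        case True
        then show ?thesis using y(1) by (auto simp: le_Suc_eq)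
      next
        case False
        then have "y u = x u" using R y(2) by blast
        then show ?thesis using V(2) by (simp add: PiE_def Pi_def)
      qed
      then show ?thesis using V(3) by (auto simp: PiE_def Pi_def)
    qed
    then show ?thesis by auto
  qed
  then show "U \<subseteq> {x. \<forall>u. x u \<le> 1} \<and>
    (\<forall>x\<in>U. \<exists>R. \<forall>y. (\<forall>u. y u \<le> 1) \<longrightarrow> (\<forall>u\<in>window R. y u = x u) \<longrightarrow> y \<in> U)"
    using openin_subset[OF U] topspace_full_shift by auto
next
  assume *: "U \<subseteq> {x. \<forall>u. x u \<le> 1} \<and>
    (\<forall>x\<in>U. \<exists>R. \<forall>y. (\<forall>u. y u \<le> 1) \<longrightarrow> (\<forall>u\<in>window R. y u = x u) \<longrightarrow> y \<in> U)"
  show "openin full_shift_space U"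
    unfolding full_shift_space_def openin_product_topology_alt
  proof (intro conjI ballI)
    fix x assume x: "x \<in> U"
    then obtain R where R: "\<And>y. (\<forall>u. y u \<le> 1) \<Longrightarrow> (\<forall>u\<in>window R. y u = x u) \<Longrightarrow> y \<in> U"
      using * by meson
    have x1: "x u \<le> 1" for u using x * by auto
    define V where "V u = (if u \<in> window R then {x u} else {0, 1})" for u
    have "finite {u \<in> UNIV. V u \<noteq> topspace (discrete_topology {0, 1})}"
      by (rule finite_subset[OF _ finite_window[of R]]) (auto simp: V_def)
    moreover have "\<forall>u\<in>UNIV. openin (discrete_topology {0, 1}) (V u)"
      using x1 by (auto simp: V_def le_Suc_eq)
    moreover have "x \<in> Pi\<^sub>E UNIV V" using x1 by (auto simp: V_def le_Suc_eq PiE_def Pi_def)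
    moreover have "Pi\<^sub>E UNIV V \<subseteq> U"
    proof
      fix y assume y: "y \<in> Pi\<^sub>E UNIV V"
      have "y u \<in> V u" for u using y by auto
      then have "(\<forall>u. y u \<le> 1)" "\<forall>u\<in>window R. y u = x u"
        using x1 unfolding V_def by (metis One_nat_def insert_iff order_refl singletonD zero_le)+
      then show "y \<in> U" by (rule R)
    qed
    ultimately show "\<exists>V. finite {u \<in> UNIV. V u \<noteq> topspace (discrete_topology {0, 1})} \<and>
       (\<forall>u\<in>UNIV. openin (discrete_topology {0, 1}) (V u)) \<and> x \<in> Pi\<^sub>E UNIV V \<and> Pi\<^sub>E UNIV V \<subseteq> U"
      by blast
  qed
qed

lemma openin_subshift:
  fixes X :: "(('n::finite \<Rightarrow> int) \<Rightarrow> nat) set"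
  assumes X: "X \<subseteq> {x. \<forall>u. x u \<le> 1}"
  shows "openin (subtopology full_shift_space X) U \<longleftrightarrow> U \<subseteq> X \<and>
    (\<forall>x\<in>U. \<exists>R. \<forall>y\<in>X. (\<forall>u\<in>window R. y u = x u) \<longrightarrow> y \<in> U)"
proof
  assume "openin (subtopology full_shift_space X) U"
  then obtain T where T: "openin full_shift_space T" "U = T \<inter> X" by (auto simp: openin_subtopology)
  have "\<exists>R. \<forall>y\<in>X. (\<forall>u\<in>window R. y u = x u) \<longrightarrow> y \<in> U" if "x \<in> U" for x
  proof -
    have "x \<in> T" using T(2) that by simp
    then obtain R where "\<forall>y. (\<forall>u. y u \<le> 1) \<longrightarrow> (\<forall>u\<in>window R. y u = x u) \<longrightarrow> y \<in> T"
      using T(1)[unfolded openin_full_shift] by (auto dest: bspec)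
    then show ?thesis using X T(2) by (intro exI[of _ R]) auto
  qed
  then show "U \<subseteq> X \<and> (\<forall>x\<in>U. \<exists>R. \<forall>y\<in>X. (\<forall>u\<in>window R. y u = x u) \<longrightarrow> y \<in> U)" using T by auto
next
  assume *: "U \<subseteq> X \<and> (\<forall>x\<in>U. \<exists>R. \<forall>y\<in>X. (\<forall>u\<in>window R. y u = x u) \<longrightarrow> y \<in> U)"
  \<comment> \<open>\<open>T\<close> consists of the 0-1 configurations having a window that forces
    points of \<open>X\<close> into \<open>U\<close>; a window occurring in no point of
    \<open>X\<close> does so vacuously.\<close>
  define T where "T = {z. (\<forall>u. z u \<le> 1) \<and>
    (\<exists>R. \<forall>y\<in>X. (\<forall>u\<in>window R. y u = z u) \<longrightarrow> y \<in> U)}"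
  have "openin full_shift_space T"
    unfolding openin_full_shift
  proof (intro conjI ballI)
    fix z assume "z \<in> T"
    then obtain R where R: "\<forall>y\<in>X. (\<forall>u\<in>window R. y u = z u) \<longrightarrow> y \<in> U" by (auto simp: T_def)
    have "w \<in> T" if w: "\<forall>u. w u \<le> 1" "\<forall>u\<in>window R. w u = z u" for w
      using R w by (auto simp: T_def intro!: exI[of _ R])
    then show "\<exists>R. \<forall>y. (\<forall>u. y u \<le> 1) \<longrightarrow> (\<forall>u\<in>window R. y u = z u) \<longrightarrow> y \<in> T" by blast
  qed (auto simp: T_def)
  moreover have "U = T \<inter> X" using * X by (auto simp: T_def)
  ultimately show "openin (subtopology full_shift_space X) U" by (auto simp: openin_subtopology)
qed

lemma zd_shift_eq: "zd_shift v x = (\<lambda>u. x (u \<boxplus> v))"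
  by (simp add: zd_shift_def vadd_def)

section \<open>The periodic configurations\<close>

lemma adjacent_div_mod:
  fixes x y l :: int
  assumes "\<bar>x - y\<bar> \<le> 1" "0 < l" "x div l \<noteq> y div l"
  shows "x mod l = 0 \<or> x mod l = l - 1" "y mod l = 0 \<or> y mod l = l - 1"
    "\<bar>x div l - y div l\<bar> \<le> 1"
proof -
  have x: "x = l * (x div l) + x mod l" "0 \<le> x mod l" "x mod l < l"
    using assms by auto
  have y: "y = l * (y div l) + y mod l" "0 \<le> y mod l" "y mod l < l"
    using assms by auto
  consider "x div l + 1 \<le> y div l" | "y div l + 1 \<le> x div l" using assms(3) by linarith
  then have "(x mod l = 0 \<or> x mod l = l - 1) \<and> (y mod l = 0 \<or> y mod l = l - 1) \<and>
      \<bar>x div l - y div l\<bar> \<le> 1"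
  proof cases
    case 1
    have "l * (x div l + 1) \<le> l * (y div l)" using 1 assms(2) by simp
    then have *: "x mod l = l - 1" "y mod l = 0" "l * (x div l + 1) = l * (y div l)"
      using x y assms(1) unfolding distrib_left by linarith+
    then have "x div l + 1 = y div l" using assms(2) by simp
    then show ?thesis using * by auto
  next
    case 2
    have "l * (y div l + 1) \<le> l * (x div l)" using 2 assms(2) by simp
    then have *: "y mod l = l - 1" "x mod l = 0" "l * (y div l + 1) = l * (x div l)"
      using x y assms(1) unfolding distrib_left by linarith+
    then have "y div l + 1 = x div l" using assms(2) by simp
    then show ?thesis using * by auto
  qed
  then show "x mod l = 0 \<or> x mod l = l - 1" "y mod l = 0 \<or> y mod l = l - 1"
    "\<bar>x div l - y div l\<bar> \<le> 1" by auto
qed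

text \<open>The end faces of a large block are also end faces of the smaller blocks that tile it.
  This passes boundary positions down the levels.\<close>

lemma mod_top_of_dvd:
  fixes x l l' :: int
  assumes "l dvd l'" "0 < l" "x mod l' = 0 \<or> x mod l' = l' - 1"
  shows "x mod l = 0 \<or> x mod l = l - 1"
proof -
  have "x mod l = x mod l' mod l" using assms(1) by (simp add: mod_mod_cancel)
  moreover have "(l' - 1) mod l = l - 1"
  proof -
    have "(l' - 1) mod l = (l' mod l - 1) mod l" by (simp add: mod_diff_left_eq)
    also have "\<dots> = (- 1) mod l" using assms(1) by (simp add: dvd_eq_mod_eq_0)
    also have "\<dots> = l - 1" using assms(2) by (simp add: zmod_minus1)
    finally show ?thesis .
  qed
  ultimately show ?thesis using assms(3) by auto
qed

text \<open>Through Bernoulli's inequality this growth makes the digit of level \<open>n\<close>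
  fall outside \<open>good n\<close> with probability at most \<open>(1 / 2) ^ (n + 3)\<close>; the
  sum of these bounds is 1/4. It also leaves room for all exceptional cells. The parameter
  \<open>index\<close> fixes the dimension.\<close>

locale block_scheme =
  fixes q :: "nat \<Rightarrow> int" and index :: "'n::finite itself"
  assumes q_ge: "int CARD('n) * (2 * int n + 10) * 2 ^ (n + 3) \<le> q n"
begin

lemma q_large: "2 * int n + 10 \<le> q n"
proof -
  have "1 * (2 * int n + 10) * 1 \<le> int CARD('n) * (2 * int n + 10) * 2 ^ (n + 3)"
    by (intro mult_mono) (auto simp: Suc_leI)
  also note q_ge
  finally show ?thesis by simp
qed

lemma q_pos: "0 < q n"
  using q_large[of n] by linarith

section \<open>Side lengths, digits and periodic patterns\<close>

fun L :: "nat \<Rightarrow> int" where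
  "L 0 = 1"
| "L (Suc n) = L n * q n"

lemma L_pos [simp]: "0 < L n"
  by (induction n) (auto simp: q_pos)

lemma L_nonneg [simp]: "0 \<le> L n" and L_neq_0 [simp]: "L n \<noteq> 0" and L_ge_1: "1 \<le> L n"
  using L_pos[of n] by linarith+

lemma L_dvd: "k \<le> n \<Longrightarrow> L k dvd L n"
  by (induction n) (auto simp: le_Suc_eq)

lemma L_growth: "(1 + int j) * L n \<le> L (n + j)"
proof (induction j)
  case (Suc j)
  have "(1 + int (Suc j)) * L n \<le> 2 * ((1 + int j) * L n)" by (simp add: algebra_simps)
  also have "\<dots> \<le> q (n + j) * L (n + j)"
    using Suc q_large[of "n + j"] by (intro mult_mono) auto
  finally show ?case by (simp add: mult.commute)
qed simp

text \<open>The vector of level-\<open>n\<close> digits of \<open>u\<close> in the mixed radix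
  system with bases \<open>q\<close>; it locates the \<open>L n\<close>-block of \<open>u\<close>
  inside its \<open>L (Suc n)\<close>-block.\<close>

definition cell :: "nat \<Rightarrow> ('n \<Rightarrow> int) \<Rightarrow> 'n \<Rightarrow> int" where
  "cell n u = (\<lambda>i. u i div L n mod q n)"

definition diag :: "nat \<Rightarrow> 'n \<Rightarrow> int" where
  "diag k = (\<lambda>_. 2 * int k + 4)"

text \<open>The exceptional cells of level \<open>n\<close> lie on the diagonal at height 2 and at the even heights
  \<open>2 k + 4\<close>, \<open>k < n\<close>, so no two of them touch and none touches the boundary of its block. Only the
  values of \<open>diag_index\<close> on diagonal cells matter.\<close>
definition diag_index :: "('n \<Rightarrow> int) \<Rightarrow> nat" where
  "diag_index c = nat ((c undefined - 4) div 2)"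

lemma diag_index_diag [simp]: "diag_index (diag k) = k"
  by (simp add: diag_index_def diag_def)

text \<open>The label \<open>a\<close> acts only in ordinary cells. The exceptional cells have the
  same content for both labels, so the old patterns occur in \<open>per n 0\<close> and in
  \<open>per n 1\<close> alike. The bound on \<open>diag_index\<close> inside the test makes the
  recursion terminate.\<close>

fun per :: "nat \<Rightarrow> nat \<Rightarrow> ('n \<Rightarrow> int) \<Rightarrow> nat" where
  "per 0 a u = a"
| "per (Suc n) a u =
    (if cell n u = (\<lambda>_. 2) then per n 1 u
     else if diag_index (cell n u) < n \<and> cell n u = diag (diag_index (cell n u))
       then per (diag_index (cell n u)) 0 u
     else per n a u)"

text \<open>\<open>kind m n a u = (k, b)\<close> says that the level-\<open>m\<close> cell of \<open>u\<close> in \<open>per n a\<close> is filled with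
  \<open>per k b\<close>, where \<open>k = m\<close>, or \<open>k < m\<close> if the cell belongs to an old periodic pattern.\<close>
fun kind :: "nat \<Rightarrow> nat \<Rightarrow> nat \<Rightarrow> ('n \<Rightarrow> int) \<Rightarrow> nat \<times> nat" where
  "kind m 0 a u = (0, a)"
| "kind m (Suc n) a u =
    (if Suc n \<le> m then (Suc n, a)
     else if cell n u = (\<lambda>_. 2) then kind m n 1 u
     else if diag_index (cell n u) < n \<and> cell n u = diag (diag_index (cell n u))
       then kind m (diag_index (cell n u)) 0 u
     else kind m n a u)"

declare per.simps(2) [simp del] kind.simps(2) [simp del]

lemma diag_neq_2 [simp]: "diag k \<noteq> (\<lambda>_. 2)"
  by (auto simp: diag_def fun_eq_iff)

text \<open>\<open>per\<close> and \<open>kind\<close> branch in the same way, so one case rule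
  serves both; it names the old pattern by \<open>k\<close> and hides \<open>diag_index\<close>. The
  equations for \<open>kind\<close> need \<open>m \<le> n\<close> because at or below level
  \<open>m\<close> the descent stops.\<close>

lemma per_Suc_cases:
  obtains "cell n u = (\<lambda>_. 2)"
      "\<And>a. per (Suc n) a u = per n 1 u" "\<And>m a. m \<le> n \<Longrightarrow> kind m (Suc n) a u = kind m n 1 u"
  | k where "k < n" "cell n u = diag k"
      "\<And>a. per (Suc n) a u = per k 0 u" "\<And>m a. m \<le> n \<Longrightarrow> kind m (Suc n) a u = kind m k 0 u"
  | "cell n u \<noteq> (\<lambda>_. 2)" "\<And>k. k < n \<Longrightarrow> cell n u \<noteq> diag k"
      "\<And>a. per (Suc n) a u = per n a u" "\<And>m a. m \<le> n \<Longrightarrow> kind m (Suc n) a u = kind m n a u"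
proof (cases "cell n u = (\<lambda>_. 2)")
  case True
  then show ?thesis by (intro that(1)) (auto simp: per.simps kind.simps)
next
  case not2: False
  show ?thesis
  proof (cases "\<exists>k<n. cell n u = diag k")
    case True
    then obtain k where "k < n" "cell n u = diag k" by auto
    then show ?thesis by (intro that(2)) (auto simp: per.simps kind.simps)
  next
    case False
    then show ?thesis using not2 by (intro that(3)) (auto simp: per.simps kind.simps)
  qed
qed

lemma per_le_1: "a \<le> 1 \<Longrightarrow> per n a u \<le> 1"
proof (induction n arbitrary: a rule: less_induct)
  case (less n)
  show ?case
  proof (cases n)
    case (Suc n')
    then show ?thesis using less by (cases rule: per_Suc_cases[of n' u]) auto
  qed (use less in auto)
qed

lemma cell_periodic:
  assumes "\<And>i. L (Suc n) dvd v i"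
  shows "cell n (u \<boxplus> v) = cell n u"
proof
  fix i
  obtain w where w: "v i = L (Suc n) * w" using assms[of i] by auto
  have "(u i + v i) div L n = (u i + L n * (q n * w)) div L n" by (simp add: w mult.assoc)
  also have "\<dots> = q n * w + u i div L n" by (rule div_mult_self2) simp
  finally show "cell n (u \<boxplus> v) i = cell n u i" by (simp add: cell_def vadd_apply)
qed

lemma per_periodic:
  assumes "\<And>i. L n dvd v i"
  shows "per n a (u \<boxplus> v) = per n a u"
  using assms
proof (induction n arbitrary: a rule: less_induct)
  case (less n)
  show ?case
  proof (cases n)
    case (Suc n')
    have c: "cell n' (u \<boxplus> v) = cell n' u" using less.prems Suc by (intro cell_periodic) auto
    have d: "per k b (u \<boxplus> v) = per k b u" if "k \<le> n'" for k b
      using that Suc less.prems L_dvd[of k n] by (intro less.IH) (auto intro: dvd_trans)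
    show ?thesis using d by (simp add: Suc per.simps c)
  qed auto
qed

lemma per_cong:
  assumes "\<And>i. u i mod L n = v i mod L n"
  shows "per n a u = per n a v"
proof -
  have "per n a (v \<boxplus> (u \<boxminus> v)) = per n a v"
    using assms by (intro per_periodic) (simp add: mod_eq_dvd_iff vminus_apply)
  then show ?thesis by simp
qed

lemma cell_eqI:
  assumes "\<And>i. c i * L n \<le> u i" "\<And>i. u i < (c i + 1) * L n" "\<And>i. 0 \<le> c i" "\<And>i. c i < q n"
  shows "cell n u = c"
proof
  fix i
  have "u i div L n = c i"
    using assms(1,2)[of i] by (intro int_div_pos_eq[of _ _ _ "u i - c i * L n"]) (auto simp: algebra_simps)
  then show "cell n u i = c i" using assms(3,4)[of i] by (simp add: cell_def)
qed

lemma per_Suc_two: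
  assumes "cell n u = (\<lambda>_. 2)"
  shows "per (Suc n) a u = per n 1 u"
  using assms by (simp add: per.simps)

lemma per_Suc_diag:
  assumes "cell n u = diag k" "k < n"
  shows "per (Suc n) a u = per k 0 u"
  using assms by (simp add: per.simps)

lemma per_Suc_generic:
  assumes "cell n u \<noteq> (\<lambda>_. 2)" "\<And>k. k < n \<Longrightarrow> cell n u \<noteq> diag k"
  shows "per (Suc n) a u = per n a u"
  using assms by (auto simp: per.simps)

text \<open>At every level the origin lies in the corner cell, which is never exceptional, so the
  label survives down to level 0.\<close>

lemma per_one_zero: "per n 1 (\<lambda>_. 0) = 1"
proof (induction n)
  case (Suc n)
  have "cell n (\<lambda>_. 0) = (\<lambda>_. 0)" by (simp add: cell_def)
  then show ?case using Suc by (subst per_Suc_generic) (auto simp: diag_def fun_eq_iff)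
qed simp

text \<open>Merges the three cases for inductions on the level. The second point \<open>v\<close>
  allows two points of one cell to be followed simultaneously.\<close>

lemma Suc_branch:
  assumes "m \<le> n" "cell n v = cell n u"
  shows "\<exists>k b. k < Suc n \<and> (k = n \<or> b = 0) \<and> (b = 0 \<or> b = 1 \<or> b = a) \<and>
    per (Suc n) a u = per k b u \<and> kind m (Suc n) a u = kind m k b u \<and>
    kind m (Suc n) a v = kind m k b v"
proof (cases rule: per_Suc_cases[of n u])
  case 1
  then show ?thesis using assms by (intro exI[of _ n] exI[of _ 1]) (auto simp: kind.simps(2))
next
  case (2 k)
  then show ?thesis using assms by (intro exI[of _ k] exI[of _ 0]) (simp add: kind.simps(2))
next
  case 3
  have "kind m (Suc n) a v = kind m n a v"
    using 3(1,2) assms by (auto simp: kind.simps(2))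
  then show ?thesis using 3 assms by (intro exI[of _ n] exI[of _ a]) simp
qed

section \<open>How the level-\<open>m\<close> cells of a pattern are filled\<close>

lemma per_kind: "per n a u = per (fst (kind m n a u)) (snd (kind m n a u)) u"
proof (induction n arbitrary: a rule: less_induct)
  case (less n)
  show ?case
  proof (cases n)
    case (Suc n')
    show ?thesis
    proof (cases "Suc n' \<le> m")
      case True then show ?thesis by (simp add: Suc kind.simps)
    next
      case False
      obtain k b where "k < n" "per n a u = per k b u" "kind m n a u = kind m k b u"
        using Suc_branch[of m n' u u a] False Suc by auto
      then show ?thesis using less.IH[of k b] by simp
    qed
  qed auto
qed

lemma kind_small: "n \<le> m \<Longrightarrow> kind m n a u = (n, a)"
  by (cases n) (auto simp: kind.simps)

text \<open>A descent by one level does not pass below \<open>m\<close>, while a jump to an old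
  pattern resets the label to 0. So label 1 can survive only at level exactly
  \<open>m\<close>.\<close>

lemma kind_range:
  assumes "m \<le> n \<or> a = 0" "a \<le> 1"
  shows "fst (kind m n a u) \<le> m \<and> snd (kind m n a u) \<le> 1 \<and>
    (fst (kind m n a u) < m \<longrightarrow> snd (kind m n a u) = 0)"
  using assms
proof (induction n arbitrary: a rule: less_induct)
  case (less n)
  show ?case
  proof (cases "n \<le> m")
    case True
    then show ?thesis using less.prems by (auto simp: kind_small)
  next
    case False
    then obtain n' where n: "n = Suc n'" "m \<le> n'" by (cases n) auto
    obtain k b where "k < n" "k = n' \<or> b = 0" "b = 0 \<or> b = 1 \<or> b = a"
      "kind m n a u = kind m k b u"
      using Suc_branch[of m n' u u a] n by auto
    then show ?thesis using less.IH[of k b] less.prems n by auto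
  qed
qed

text \<open>Exceptional cells avoid the faces of their block. A point on a face therefore passes
  only through ordinary cells until level \<open>m\<close> is reached; one extreme coordinate is
  enough.\<close>

lemma kind_boundary:
  assumes "m \<le> n" "u i mod L n = 0 \<or> u i mod L n = L n - 1"
  shows "fst (kind m n a u) = m"
  using assms
proof (induction n)
  case 0
  then show ?case by simp
next
  case (Suc n)
  show ?case
  proof (cases "Suc n = m")
    case True
    then show ?thesis by (simp add: kind_small)
  next
    case False
    then have mn: "m \<le> n" using Suc.prems by simp
    have "u i mod L (Suc n) = L n * (u i div L n mod q n) + u i mod L n"
      using q_pos[of n] by (simp add: zmod_zmult2_eq)
    then have e: "u i mod L (Suc n) = L n * cell n u i + u i mod L n" by (simp add: cell_def)
    have r: "0 \<le> u i mod L n" "u i mod L n < L n" "0 \<le> cell n u i" "cell n u i < q n"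
      using q_pos[of n] by (auto simp: cell_def)
    \<comment> \<open>An extreme residue modulo \<open>L (Suc n)\<close> forces an extreme digit in
      the same coordinate.\<close>
    have "cell n u i = 0 \<or> cell n u i = q n - 1"
      using Suc.prems(2)
    proof
      assume "u i mod L (Suc n) = 0"
      then have "L n * cell n u i + u i mod L n = 0" using e by simp
      moreover have "0 \<le> L n * cell n u i" using r by simp
      ultimately have "L n * cell n u i = 0" using r by linarith
      then show ?thesis by simp
    next
      assume "u i mod L (Suc n) = L (Suc n) - 1"
      then have "L n * cell n u i + u i mod L n = L n * q n - 1" using e by simp
      then have "L n * (q n - cell n u i - 1) \<le> 0" using r(2) unfolding right_diff_distrib by linarith
      then have "q n - cell n u i - 1 \<le> 0" using L_pos[of n] by (auto simp: mult_le_0_iff)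
      then show ?thesis using r by linarith
    qed
    then have "cell n u i \<noteq> 2" "\<And>k. k < n \<Longrightarrow> cell n u i \<noteq> diag k i"
      using q_large[of n] by (auto simp: diag_def)
    then have "cell n u \<noteq> (\<lambda>_. 2)" "\<And>k. k < n \<Longrightarrow> cell n u \<noteq> diag k"
      by metis+
    then have "kind m (Suc n) a u = kind m n a u"
      using mn by (cases rule: per_Suc_cases[of n u]) auto
    moreover have "fst (kind m n a u) = m"
      using mn mod_top_of_dvd[OF L_dvd[of n "Suc n"] _ Suc.prems(2)] by (intro Suc.IH) auto
    ultimately show ?thesis by simp
  qed
qed

lemma div_L_coarsen:
  assumes "m \<le> n" "x div L m = y div L m"
  shows "x div L n = y div L n"
proof -
  obtain t where t: "L n = L m * t" using L_dvd[OF assms(1)] by auto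
  have "0 < t" using L_pos[of m] L_pos[of n] t by (metis zero_less_mult_pos)
  then show ?thesis using assms(2) by (simp add: t zdiv_zmult2_eq)
qed

lemma kind_same_cell:
  assumes "\<And>i. u i div L m = v i div L m"
  shows "kind m n a u = kind m n a v"
proof (induction n arbitrary: a rule: less_induct)
  case (less n)
  show ?case
  proof (cases "n \<le> m")
    case True
    then show ?thesis by (simp add: kind_small)
  next
    case False
    then obtain n' where n: "n = Suc n'" "m \<le> n'" by (cases n) auto
    have "u i div L n' = v i div L n'" for i using assms[of i] by (rule div_L_coarsen[OF n(2)])
    then have "cell n' v = cell n' u" by (simp add: cell_def)
    then obtain k b where "k < n" "kind m n a u = kind m k b u" "kind m n a v = kind m k b v"
      using Suc_branch[of m n' v u a] n by auto
    then show ?thesis using less.IH[of k b] by simp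
  qed
qed

text \<open>Different old patterns never touch. Inside one cell the claim descends by induction.
  Across a wall both points lie on faces of their cells, which leaves only diagonal cells, and two
  different diagonal cells are never neighbours.\<close>

lemma kind_adjacent:
  assumes "\<And>i. \<bar>u i - v i\<bar> \<le> 1" "fst (kind m n a u) < m" "fst (kind m n a v) < m"
  shows "kind m n a u = kind m n a v"
  using assms(2,3)
proof (induction n arbitrary: a rule: less_induct)
  case (less n)
  show ?case
  proof (cases "n \<le> m")
    case True
    then show ?thesis by (simp add: kind_small)
  next
    case False
    then obtain n' where n: "n = Suc n'" "m \<le> n'" by (cases n) auto
    show ?thesis
    proof (cases "\<forall>i. u i div L n' = v i div L n'")
      case True
      then have "cell n' v = cell n' u" by (simp add: cell_def)
      then obtain k b where "k < n" "kind m n a u = kind m k b u" "kind m n a v = kind m k b v"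
        using Suc_branch[of m n' v u a] n by auto
      then show ?thesis using less.IH[of k b] less.prems by simp
    next
      case False
      then obtain i where i: "u i div L n' \<noteq> v i div L n'" by auto
      note ad = adjacent_div_mod[OF assms(1) L_pos i]
      \<comment> \<open>In an ordinary cell, in cell 2, or in a diagonal cell with
        \<open>k \<ge> m\<close>, \<open>kind_boundary\<close> would give level exactly
        \<open>m\<close>.\<close>
      have *: "\<exists>k<n'. cell n' w = diag k \<and> kind m n a w = (k, 0)"
        if w: "w i mod L n' = 0 \<or> w i mod L n' = L n' - 1" "fst (kind m n a w) < m" for w
      proof (cases rule: per_Suc_cases[of n' w])
        case 1
        then show ?thesis using kind_boundary[where u = w and i = i, OF n(2) w(1)] w(2) n by simp
      next
        case (2 k)
        have "k < m"
        proof (rule ccontr)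
          assume "\<not> k < m"
          then have "fst (kind m k 0 w) = m"
            using mod_top_of_dvd[where x = "w i", OF L_dvd[of k n'] L_pos w(1)] 2 by (intro kind_boundary) auto
          then show False using 2 w n by simp
        qed
        then show ?thesis using 2 n by (auto simp: kind_small)
      next
        case 3
        then show ?thesis using kind_boundary[where u = w and i = i, OF n(2) w(1)] w(2) n by simp
      qed
      obtain k where k: "k < n'" "cell n' u = diag k" "kind m n a u = (k, 0)"
        using *[of u, OF ad(1)] less.prems by auto
      obtain k' where k': "k' < n'" "cell n' v = diag k'" "kind m n a v = (k', 0)"
        using *[of v, OF ad(2)] less.prems by auto
      have "u i div L n' mod q n' = 2 * int k + 4" "v i div L n' mod q n' = 2 * int k' + 4"
        using k(2) k'(2) by (auto simp: cell_def diag_def fun_eq_iff)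
      moreover have "0 < q n'" "2 * int n' + 10 \<le> q n'" by (rule q_pos, rule q_large)
      \<comment> \<open>Diagonal cells are interior, so both cells belong to the same block of the
        next level and their digits in coordinate \<open>i\<close> differ by at most one. Equal
        parity of the heights then gives \<open>k = k'\<close>.\<close>
      ultimately have "\<bar>(2 * int k + 4) - (2 * int k' + 4)\<bar> \<le> 1"
      proof -
        assume h: "u i div L n' mod q n' = 2 * int k + 4" "v i div L n' mod q n' = 2 * int k' + 4"
          "0 < q n'" "2 * int n' + 10 \<le> q n'"
        have "u i div L n' div q n' = v i div L n' div q n'"
          using adjacent_div_mod(1)[OF ad(3) h(3)] h k(1) by fastforce
        then have "u i div L n' mod q n' - v i div L n' mod q n' = u i div L n' - v i div L n'"
          by (metis add_diff_cancel_left mult_div_mod_eq)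
        then show ?thesis using ad(3) h by linarith
      qed
      then have "k = k'" by presburger
      then show ?thesis using k k' by simp
    qed
  qed
qed

section \<open>The chaotic almost minimal system\<close>

text \<open>The closure of the orbits of all \<open>per n 0\<close>, written out window by
  window.\<close>

definition X :: "(('n \<Rightarrow> int) \<Rightarrow> nat) set" where
  "X = {x. \<forall>R. \<exists>v n. \<forall>u\<in>window R. x u = per n 0 (u \<boxplus> v)}"

lemma X_windowE:
  assumes "x \<in> X"
  obtains v n where "\<forall>u\<in>window R. x u = per n 0 (u \<boxplus> v)"
proof -
  have "\<exists>v n. \<forall>u\<in>window R. x u = per n 0 (u \<boxplus> v)" using assms unfolding X_def by simp
  then show ?thesis using that by blast
qed

lemma X_le_1: "X \<subseteq> {x. \<forall>u. x u \<le> 1}"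
proof
  fix x assume x: "x \<in> X"
  have "x u \<le> 1" for u
  proof -
    obtain R where "u \<in> window R" using finite_subset_window[of "{u}"] by auto
    moreover obtain v n where "\<forall>u\<in>window R. x u = per n 0 (u \<boxplus> v)" by (rule X_windowE[OF x])
    ultimately show ?thesis using per_le_1[of 0] by simp
  qed
  then show "x \<in> {x. \<forall>u. x u \<le> 1}" by simp
qed

lemma per_in_X: "(\<lambda>u. per n 0 (u \<boxplus> v)) \<in> X"
  by (auto simp: X_def)

lemma subshift_X: "subshift X"
  unfolding subshift_def
proof
  show "closedin full_shift_space X"
    unfolding closedin_def openin_full_shift topspace_full_shift
  proof (intro conjI ballI)
    fix x assume "x \<in> {x. \<forall>u. x u \<le> 1} - X"
    then obtain R where R: "\<And>v n. \<not> (\<forall>u\<in>window R. x u = per n 0 (u \<boxplus> v))"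
      unfolding X_def by blast
    have "y \<notin> X" if "\<forall>u\<in>window R. y u = x u" for y
    proof
      assume "y \<in> X"
      then obtain v n where "\<forall>u\<in>window R. y u = per n 0 (u \<boxplus> v)" by (rule X_windowE)
      then show False using R that by auto
    qed
    then show "\<exists>R. \<forall>y. (\<forall>u. y u \<le> 1) \<longrightarrow> (\<forall>u\<in>window R. y u = x u) \<longrightarrow>
        y \<in> {x. \<forall>u. x u \<le> 1} - X"
      by blast
  qed (use X_le_1 in auto)
  show "shift_invariant X"
    unfolding shift_invariant_def
  proof (intro allI subsetI)
    fix v y assume "y \<in> zd_shift v ` X"
    then obtain x where x: "x \<in> X" "y = zd_shift v x" by auto
    show "y \<in> X"
      unfolding X_def
    proof (intro CollectI allI)
      fix R
      obtain R' where R': "(\<lambda>u. u \<boxplus> v) ` window R \<subseteq> window R'"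
        using finite_subset_window finite_window by blast
      obtain w n where w: "\<forall>u\<in>window R'. x u = per n 0 (u \<boxplus> w)" by (rule X_windowE[OF x(1)])
      have "y u = per n 0 (u \<boxplus> (v \<boxplus> w))" if "u \<in> window R" for u
        using w R' that by (auto simp: x(2) zd_shift_eq vadd_assoc image_subset_iff)
      then show "\<exists>v n. \<forall>u\<in>window R. y u = per n 0 (u \<boxplus> v)" by blast
    qed
  qed
qed

text \<open>From some level on, the cell \<open>diag n\<close> is large enough to show any
  prescribed window of \<open>per n 0\<close>, and its content does not depend on the label
  \<open>a\<close>. The bounds on \<open>u i + w i\<close> keep the copy inside one block, so that
  it can be moved to any block filled with \<open>per (Suc m) a\<close>.\<close>

lemma per_embeds:
  fixes R n :: nat
  shows "\<exists>m0. \<forall>m\<ge>m0. \<forall>a v. \<exists>w. \<forall>u\<in>window R. per (Suc m) a (u \<boxplus> w) = per n 0 (u \<boxplus> v) \<and>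
    (\<forall>i::'n. 0 \<le> u i + w i \<and> u i + w i < L (Suc m))"
\<comment> \<open>This threshold gives both \<open>n < m\<close> and
  \<open>(2 * R + 1) * L n \<le> L m\<close>.\<close>
proof (intro exI[of _ "n + 2 * R + 1"] allI impI)
  fix m a and v :: "'n \<Rightarrow> int" assume m: "n + 2 * R + 1 \<le> m"
  define j where "j = m - n"
  have "(1 + int j) * L n \<le> L (n + j)" by (rule L_growth)
  moreover have "(2 * int R + 1) * L n \<le> (1 + int j) * L n"
    using m by (intro mult_right_mono) (auto simp: j_def)
  ultimately have big: "2 * (int R * L n) + L n \<le> L m" using m by (simp add: j_def algebra_simps)
  have RL: "int R \<le> int R * L n" using L_ge_1[of n] by (simp add: mult_le_cancel_left1)
  \<comment> \<open>Start at the corner of cell \<open>diag n\<close>, add a margin of at least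
    \<open>R\<close> that is a multiple of \<open>L n\<close> and so keeps the phase, then add the
    phase of \<open>v\<close>.\<close>
  define w where "w = (\<lambda>i. (2 * int n + 4) * L m + (int R * L n + v i mod L n))"
  show "\<exists>w. \<forall>u\<in>window R. per (Suc m) a (u \<boxplus> w) = per n 0 (u \<boxplus> v) \<and>
    (\<forall>i. 0 \<le> u i + w i \<and> u i + w i < L (Suc m))"
  proof (intro exI[of _ w] ballI conjI)
    fix u :: "'n \<Rightarrow> int" assume u: "u \<in> window R"
    have lo: "(2 * int n + 4) * L m \<le> u i + w i" and hi: "u i + w i < (2 * int n + 4) * L m + L m" for i
    proof -
      have "\<bar>u i\<bar> \<le> int R" using u by (simp add: window_def)
      moreover have "0 \<le> v i mod L n" "v i mod L n < L n" by auto
      ultimately show "(2 * int n + 4) * L m \<le> u i + w i" "u i + w i < (2 * int n + 4) * L m + L m"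
        using big RL unfolding w_def by linarith+
    qed
    have "cell m (u \<boxplus> w) = diag n"
      using lo hi q_large[of m] m by (intro cell_eqI) (auto simp: diag_def algebra_simps vadd_apply)
    then have "per (Suc m) a (u \<boxplus> w) = per n 0 (u \<boxplus> w)"
      using m by (intro per_Suc_diag) auto
    also have "\<dots> = per n 0 (u \<boxplus> v)"
    proof (rule per_cong, unfold vadd_apply)
      fix i
      have "L n dvd L m" using m by (intro L_dvd) auto
      then obtain t where t: "L m = L n * t" by auto
      have "u i + w i = (u i + v i mod L n) + L n * ((2 * int n + 4) * t + int R)"
        by (simp add: w_def t algebra_simps)
      then have "(u i + w i) mod L n = (u i + v i mod L n) mod L n"
        by (simp only: mod_mult_self2)
      then show "(u i + w i) mod L n = (u i + v i) mod L n"
        by (simp add: mod_add_right_eq)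
    qed
    finally show "per (Suc m) a (u \<boxplus> w) = per n 0 (u \<boxplus> v)" .
    have "(2 * int n + 4) * L m + L m \<le> L (Suc m)"
    proof -
      have "(2 * int n + 5) * L m \<le> q m * L m"
        using q_large[of m] m by (intro mult_right_mono) auto
      then show ?thesis by (simp add: algebra_simps)
    qed
    moreover have "0 \<le> (2 * int n + 4) * L m" by simp
    ultimately show "\<forall>i. 0 \<le> u i + w i \<and> u i + w i < L (Suc m)" using lo hi by (meson order.trans less_le_trans)
  qed
qed

text \<open>For large \<open>m\<close> the orbit of the single configuration
  \<open>per (Suc m) 0\<close> meets both open sets.\<close>

lemma transitive_X: "topologically_transitive X"
  unfolding topologically_transitive_def openin_subshift[OF X_le_1]
proof (intro allI impI, elim conjE)
  fix U V :: "(('n \<Rightarrow> int) \<Rightarrow> nat) set"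
  assume U: "U \<subseteq> X" "\<forall>x\<in>U. \<exists>R. \<forall>y\<in>X. (\<forall>u\<in>window R. y u = x u) \<longrightarrow> y \<in> U" "U \<noteq> {}"
    and V: "V \<subseteq> X" "\<forall>x\<in>V. \<exists>R. \<forall>y\<in>X. (\<forall>u\<in>window R. y u = x u) \<longrightarrow> y \<in> V" "V \<noteq> {}"
  have *: "\<exists>m0. \<forall>m\<ge>m0. \<exists>w. (\<lambda>u. per (Suc m) 0 (u \<boxplus> w)) \<in> W"
    if W: "W \<subseteq> X" "\<forall>x\<in>W. \<exists>R. \<forall>y\<in>X. (\<forall>u\<in>window R. y u = x u) \<longrightarrow> y \<in> W" "W \<noteq> {}" for W
  proof -
    obtain x where x: "x \<in> W" using W(3) by auto
    obtain R where R: "\<forall>y\<in>X. (\<forall>u\<in>window R. y u = x u) \<longrightarrow> y \<in> W" using W(2) x by blast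
    have "x \<in> X" using x W(1) by blast
    then obtain v n where v: "\<forall>u\<in>window R. x u = per n 0 (u \<boxplus> v)" by (rule X_windowE)
    obtain m0 where m0: "\<forall>m\<ge>m0. \<forall>a v. \<exists>w. \<forall>u\<in>window R. per (Suc m) a (u \<boxplus> w) = per n 0 (u \<boxplus> v) \<and>
      (\<forall>i. 0 \<le> u i + w i \<and> u i + w i < L (Suc m))" using per_embeds[of R n] by auto
    have "\<exists>w. (\<lambda>u. per (Suc m) 0 (u \<boxplus> w)) \<in> W" if m: "m \<ge> m0" for m
    proof -
      obtain w where "\<forall>u\<in>window R. per (Suc m) 0 (u \<boxplus> w) = per n 0 (u \<boxplus> v) \<and>
          (\<forall>i. 0 \<le> u i + w i \<and> u i + w i < L (Suc m))"
        using spec[OF spec[OF mp[OF spec[OF m0, of m] m], of 0], of v] by (rule exE)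
      then show ?thesis using R per_in_X[of "Suc m" w] v by (intro exI[of _ w]) auto
    qed
    then show ?thesis by auto
  qed
  obtain m1 m2 where "\<forall>m\<ge>m1. \<exists>w. (\<lambda>u. per (Suc m) 0 (u \<boxplus> w)) \<in> U"
    "\<forall>m\<ge>m2. \<exists>w. (\<lambda>u. per (Suc m) 0 (u \<boxplus> w)) \<in> V" using *[OF U] *[OF V] by auto
  then obtain w1 w2 where w: "(\<lambda>u. per (Suc (max m1 m2)) 0 (u \<boxplus> w1)) \<in> U"
    "(\<lambda>u. per (Suc (max m1 m2)) 0 (u \<boxplus> w2)) \<in> V" by (meson max.cobounded1 max.cobounded2)
  have "zd_shift (w2 \<boxminus> w1) (\<lambda>u. per (Suc (max m1 m2)) 0 (u \<boxplus> w1)) =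
    (\<lambda>u. per (Suc (max m1 m2)) 0 (u \<boxplus> w2))" by (simp add: zd_shift_eq vadd_assoc)
  then show "\<exists>g. zd_shift g ` U \<inter> V \<noteq> {}" using w
    by (intro exI[of _ "w2 \<boxminus> w1"]) (metis IntI empty_iff imageI)
qed

section \<open>Periodic points and proper closed invariant subsets\<close>

definition per_orbits :: "nat \<Rightarrow> (('n \<Rightarrow> int) \<Rightarrow> nat) set" where
  "per_orbits m = (\<Union>k\<le>m. range (\<lambda>v u. per k 0 (u \<boxplus> v)))"

lemma per_in_orbits: "k \<le> m \<Longrightarrow> (\<lambda>u. per k 0 (u \<boxplus> v)) \<in> per_orbits m"
  unfolding per_orbits_def by (rule UN_I[of k]) auto

lemma finite_per_orbits: "finite (per_orbits m)"
proof -
  have "finite (range (\<lambda>v u. per k 0 (u \<boxplus> v)))" for k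
  proof (rule finite_subset)
    show "range (\<lambda>v u. per k 0 (u \<boxplus> v)) \<subseteq>
      (\<lambda>v u. per k 0 (u \<boxplus> v)) ` {v. \<forall>i. 0 \<le> v i \<and> v i < L k}"
    proof clarify
      fix v
      have "(\<lambda>u. per k 0 (u \<boxplus> v)) = (\<lambda>u. per k 0 (u \<boxplus> (\<lambda>i. v i mod L k)))"
        by (intro ext per_cong) (simp add: mod_add_right_eq vadd_apply)
      then show "(\<lambda>u. per k 0 (u \<boxplus> v)) \<in>
          (\<lambda>v u. per k 0 (u \<boxplus> v)) ` {v. \<forall>i. 0 \<le> v i \<and> v i < L k}"
        by (intro image_eqI) auto
    qed
  qed (intro finite_imageI finite_int_box)
  then show ?thesis by (simp add: per_orbits_def)
qed

lemma periodic_per: "periodic_point (\<lambda>u. per k 0 (u \<boxplus> v))"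
  unfolding periodic_point_def
proof (rule finite_subset[OF _ finite_per_orbits[of k]])
  show "range (\<lambda>g. zd_shift g (\<lambda>u. per k 0 (u \<boxplus> v))) \<subseteq> per_orbits k"
    by (auto simp: zd_shift_eq vadd_assoc intro: per_in_orbits)
qed

lemma periodic_dense:
  "(subtopology full_shift_space X) closure_of {x\<in>X. periodic_point x} = X"
proof
  have "topspace (subtopology full_shift_space X) = X" using X_le_1 by (auto simp: topspace_full_shift)
  then show "(subtopology full_shift_space X) closure_of {x\<in>X. periodic_point x} \<subseteq> X"
    using closure_of_subset_topspace by metis
  show "X \<subseteq> (subtopology full_shift_space X) closure_of {x\<in>X. periodic_point x}"
  proof
    fix x assume x: "x \<in> X"
    show "x \<in> (subtopology full_shift_space X) closure_of {x\<in>X. periodic_point x}"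
      unfolding in_closure_of
    proof (intro conjI allI impI)
      show "x \<in> topspace (subtopology full_shift_space X)" 
        using x X_le_1 by (auto simp: topspace_full_shift)
      fix T assume "x \<in> T \<and> openin (subtopology full_shift_space X) T"
      then obtain R where R: "\<forall>y\<in>X. (\<forall>u\<in>window R. y u = x u) \<longrightarrow> y \<in> T"
        unfolding openin_subshift[OF X_le_1] by blast
      obtain v n where v: "\<forall>u\<in>window R. x u = per n 0 (u \<boxplus> v)" using x by (rule X_windowE)
      then show "\<exists>y. y \<in> {x\<in>X. periodic_point x} \<and> y \<in> T"
        using R per_in_X[of n v] periodic_per[of n v]
        by (intro exI[of _ "\<lambda>u. per n 0 (u \<boxplus> v)"]) auto
    qed
  qed
qed

text \<open>Moving every nonzero coordinate one step towards 0 leads from \<open>u\<close> to the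
  centre through adjacent points of the window, and \<open>kind_adjacent\<close> applies to each
  step.\<close>

lemma kind_constant:
  assumes "\<And>u. u \<in> window N \<Longrightarrow> fst (kind m n a (u \<boxplus> v)) < m" "u \<in> window N"
  shows "kind m n a (u \<boxplus> v) = kind m n a v"
  using assms
proof (induction N arbitrary: u)
  case 0
  then have "u i = 0" for i by (simp add: window_def)
  then show ?case by simp
next
  case (Suc N)
  define w where "w = (\<lambda>i. u i - sgn (u i))"
  have u: "\<bar>u i\<bar> \<le> int (Suc N)" for i using Suc.prems(2) by (simp add: window_def)
  have w: "w \<in> window N"
    unfolding window_def
  proof (intro CollectI allI)
    fix i show "\<bar>w i\<bar> \<le> int N" using u[of i] by (auto simp: w_def sgn_if)
  qed
  have sub: "window N \<subseteq> window (Suc N)" by (rule window_mono) simp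
  have "kind m n a (u \<boxplus> v) = kind m n a (w \<boxplus> v)"
  proof (rule kind_adjacent)
    show "\<bar>(u \<boxplus> v) i - (w \<boxplus> v) i\<bar> \<le> 1" for i by (simp add: w_def sgn_if vadd_apply)
  qed (use Suc.prems w sub in blast)+
  also have "\<dots> = kind m n a v" using w Suc.prems(1) sub by (intro Suc.IH) auto
  finally show ?case .
qed

text \<open>A proper closed invariant set avoids some window, which occurs in \<open>per m 0\<close>
  and \<open>per m 1\<close> for a suitable \<open>m\<close>. Its points can then show only old
  patterns \<open>per k 0\<close> with \<open>k < m\<close>, and adjacency allows just one of them
  in each window.\<close>

lemma finite_of_proper:
  assumes Y: "Y \<subseteq> X" "Y \<noteq> X" "closedin (subtopology full_shift_space X) Y" "shift_invariant Y"
  shows "finite Y"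
proof -
  have "openin (subtopology full_shift_space X) (X - Y)"
    using Y(3) X_le_1 by (auto simp: closedin_def topspace_full_shift Int_absorb1)
  moreover obtain x where x: "x \<in> X" "x \<notin> Y" using Y by auto
  ultimately obtain R where R: "\<And>y. y \<in> X \<Longrightarrow> (\<forall>u\<in>window R. y u = x u) \<Longrightarrow> y \<notin> Y"
    unfolding openin_subshift[OF X_le_1] by blast
  obtain v n where v: "\<forall>u\<in>window R. x u = per n 0 (u \<boxplus> v)" using x(1) by (rule X_windowE)
  have avoid: False if y: "y \<in> Y" "\<And>r. r \<in> window R \<Longrightarrow> y (r \<boxplus> t) = per n 0 (r \<boxplus> v)" for y t
  proof -
    have "zd_shift t y \<in> Y" using Y(4) y(1) by (auto simp: shift_invariant_def)
    moreover have "\<forall>u\<in>window R. zd_shift t y u = x u" using y(2) v by (simp add: zd_shift_eq)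
    ultimately show False using R Y(1) by blast
  qed
  obtain m0 where m0: "\<forall>m\<ge>m0. \<forall>a v. \<exists>w. \<forall>u\<in>window R. per (Suc m) a (u \<boxplus> w) = per n 0 (u \<boxplus> v) \<and>
      (\<forall>i. 0 \<le> u i + w i \<and> u i + w i < L (Suc m))" using per_embeds[of R n] by auto
  define m where "m = Suc m0"
  \<comment> \<open>Both labels are covered: a full level-\<open>m\<close> block always contains the
    forbidden window.\<close>
  have emb: "\<exists>w. \<forall>u\<in>window R. per m a (u \<boxplus> w) = per n 0 (u \<boxplus> v) \<and>
      (\<forall>i. 0 \<le> u i + w i \<and> u i + w i < L m)" for a using m0 by (auto simp: m_def)
  have approx: "\<exists>f\<in>per_orbits m. \<forall>u\<in>window N. y u = f u" if y: "y \<in> Y" for y N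
  proof -
    have "y \<in> X" using y Y(1) by blast
    \<comment> \<open>The margin \<open>L m\<close> makes the whole level-\<open>m\<close> block of
      every point of \<open>window N\<close> visible.\<close>
    then obtain v' M where v': "\<forall>u\<in>window (N + nat (L m)). y u = per M 0 (u \<boxplus> v')"
      by (rule X_windowE)
    have sub: "window N \<subseteq> window (N + nat (L m))" by (rule window_mono) simp
    show ?thesis
    proof (cases "M < m")
      case True
      then show ?thesis using v' sub
        by (intro bexI[of _ "\<lambda>u. per M 0 (u \<boxplus> v')"]) (auto intro: per_in_orbits)
    next
      case False
      then have M: "m \<le> M" by simp
      \<comment> \<open>A cell filled with \<open>per m a\<close> and meeting
        \<open>window N\<close> would lie in the enlarged window and exhibit the forbidden window in
        \<open>y\<close>.\<close>
      have small: "fst (kind m M 0 (u \<boxplus> v')) < m" if u: "u \<in> window N" for u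
      proof (rule ccontr)
        define a where "a = snd (kind m M 0 (u \<boxplus> v'))"
        assume "\<not> fst (kind m M 0 (u \<boxplus> v')) < m"
        then have k: "kind m M 0 (u \<boxplus> v') = (m, a)"
          using kind_range[of m M 0 "u \<boxplus> v'"] M by (auto simp: a_def prod_eq_iff)
        obtain w where w: "\<forall>r\<in>window R. per m a (r \<boxplus> w) = per n 0 (r \<boxplus> v) \<and>
            (\<forall>i. 0 \<le> r i + w i \<and> r i + w i < L m)" using emb[of a] by (rule exE)
        \<comment> \<open>The corner of the level-\<open>m\<close> block containing
          \<open>u \<boxplus> v'\<close>.\<close>
        define s where "s = (\<lambda>i. L m * ((u i + v' i) div L m))"
        show False
        proof (rule avoid[OF y, of "s \<boxplus> w \<boxminus> v'"])
          fix r :: "'n \<Rightarrow> int" assume r: "r \<in> window R"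
          define z where "z = r \<boxplus> w \<boxplus> s"
          have zi: "z i div L m = (u i + v' i) div L m" for i
            using bspec[OF w r] by (simp add: z_def s_def div_pos_pos_trivial vadd_apply)
          have "z \<boxminus> v' \<in> window (N + nat (L m))"
            unfolding window_def vminus_apply
          proof (intro CollectI allI)
            fix i
            have "z i - (u i + v' i) = z i mod L m - (u i + v' i) mod L m"
              using zi[of i] by (metis add_diff_cancel_left mult_div_mod_eq)
            moreover have "0 \<le> z i mod L m" "z i mod L m < L m" "0 \<le> (u i + v' i) mod L m"
              "(u i + v' i) mod L m < L m" by auto
            moreover have "\<bar>u i\<bar> \<le> int N" using u by (simp add: window_def)
            ultimately show "\<bar>z i - v' i\<bar> \<le> int (N + nat (L m))"
              using L_pos[of m] by linarith
          qed
          then have "y (z \<boxminus> v') = per M 0 z" using v' by simp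
          also have "\<dots> = per m a z"
          proof -
            have "kind m M 0 z = kind m M 0 (u \<boxplus> v')" using zi by (intro kind_same_cell) (simp add: vadd_apply)
            then show ?thesis using per_kind[of M 0 z m] k by simp
          qed
          also have "\<dots> = per m a (r \<boxplus> w)" unfolding z_def by (rule per_periodic) (simp add: s_def)
          also have "\<dots> = per n 0 (r \<boxplus> v)" using bspec[OF w r] by simp
          finally show "y (r \<boxplus> (s \<boxplus> w \<boxminus> v')) = per n 0 (r \<boxplus> v)"
            by (simp add: z_def vadd_def vminus_def algebra_simps)
        qed
      qed
      \<comment> \<open>Every point of the window lies in an old pattern, so by
        \<open>kind_constant\<close> all have the kind found at the centre.\<close>
      define k where "k = fst (kind m M 0 v')"
      have "(\<lambda>_. 0) \<in> window N" by (simp add: window_def)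
      from small[OF this] have "k < m" "kind m M 0 v' = (k, 0)"
        using kind_range[of m M 0 v'] M by (auto simp: k_def prod_eq_iff)
      then have "y u = per k 0 (u \<boxplus> v')" if "u \<in> window N" for u
        using kind_constant[of N m M 0 v' u] small that per_kind[of M 0 "u \<boxplus> v'" m] bspec[OF v', of u] sub by auto
      then show ?thesis using \<open>k < m\<close>
        by (intro bexI[of _ "\<lambda>u. per k 0 (u \<boxplus> v')"]) (auto intro: per_in_orbits)
    qed
  qed
  \<comment> \<open>There are finitely many candidates. If \<open>y\<close> differed from each of
    them somewhere, a window containing one differing site per candidate would contradict
    \<open>approx\<close>.\<close>
  have "y \<in> per_orbits m" if y: "y \<in> Y" for y
  proof (rule ccontr)
    assume "y \<notin> per_orbits m"
    then have "\<forall>f\<in>per_orbits m. y \<noteq> f" by blast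
    then have ex: "\<forall>f\<in>per_orbits m. \<exists>u. y u \<noteq> f u" unfolding fun_eq_iff by simp
    define d where "d f = (SOME u. y u \<noteq> f u)" for f
    have d: "y (d f) \<noteq> f (d f)" if "f \<in> per_orbits m" for f
      unfolding d_def using bspec[OF ex that] by (rule someI_ex)
    obtain N where "d ` per_orbits m \<subseteq> window N"
      using finite_subset_window finite_per_orbits by blast
    moreover obtain f where f: "f \<in> per_orbits m" "\<forall>u\<in>window N. y u = f u"
      using approx[OF y, of N] by (elim bexE)
    ultimately have "y (d f) = f (d f)" by (simp add: image_subset_iff)
    then show False using d f(1) by simp
  qed
  then have "Y \<subseteq> per_orbits m" by (rule subsetI)
  then show ?thesis by (rule finite_subset[OF _ finite_per_orbits])
qed

section \<open>Faithfulness of the action\<close>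

lemma cell_decompose:
  assumes "\<And>i. u i = L (Suc n) * a i + L n * c i + r i"
    "\<And>i. 0 \<le> r i \<and> r i < L n" "\<And>i. 0 \<le> c i \<and> c i < q n"
  shows "cell n u = c"
proof -
  have "u = (\<lambda>i. L n * c i + r i) \<boxplus> (\<lambda>i. L (Suc n) * a i)"
    using assms(1) by (simp add: fun_eq_iff vadd_apply)
  then have "cell n u = cell n (\<lambda>i. L n * c i + r i)"
    using cell_periodic[of n "\<lambda>i. L (Suc n) * a i"] by simp
  also have "\<dots> = c"
    using assms(2,3) by (intro cell_eqI) (auto simp: algebra_simps)
  finally show ?thesis .
qed

text \<open>The zero cell \<open>diag 0\<close> is adjacent to ordinary cells, so translating a symbol 1 close to their
  common face by a multiple of \<open>g\<close> moves it into the zero cell.\<close>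
lemma no_period:
  fixes g :: "'n \<Rightarrow> int"
  assumes per: "\<And>n u. per n 0 (u \<boxplus> g) = per n 0 u" and gi: "0 < g i" "\<And>k. \<bar>g k\<bar> \<le> g i"
  shows False
proof -
  define p where "p = nat (g i)"
  have Lp: "g i \<le> L p" using L_growth[of p 0] gi by (simp add: p_def)
  define l0 l1 l2 where "l0 = L p" and "l1 = L (Suc p)" and "l2 = L (Suc (Suc p))"
  have l1: "10 * l0 \<le> l1" using q_large[of p] by (simp add: l0_def l1_def)
  have l2: "10 * l1 \<le> l2" using q_large[of "Suc p"] mult_left_mono[of 10 "q (Suc p)" "L (Suc p)"] L_nonneg[of "Suc p"]
    unfolding l1_def l2_def L.simps(2)[of "Suc p"] by linarith
  have l0: "1 \<le> l0" "g i \<le> l0" using L_ge_1 Lp by (auto simp: l0_def)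
  \<comment> \<open>In direction \<open>i\<close> the site \<open>s\<close> lies
    \<open>2 * l0\<close> beyond the face between \<open>diag 0\<close> and its neighbour, and in
    the other directions it is well inside. Its cells at levels \<open>p + 2\<close> and
    \<open>p + 1\<close> are ordinary, and at level \<open>p\<close> it is the corner of cell 2, so
    it carries 1.\<close>
  define s where "s = (\<lambda>k. if k = i then 5 * l2 + 2 * l0 else 4 * l2 + 5 * l1 + 2 * l0)"
  \<comment> \<open>The least \<open>t\<close> with \<open>t * g i\<close> above
    \<open>2 * l0\<close>. The overshoot is at most \<open>g i \<le> l0\<close>, so subtracting
    \<open>t\<close> times \<open>g\<close> carries \<open>s\<close> into the zero cell without
    leaving it through another face.\<close>
  define t where "t = nat (2 * l0 div g i + 1)"
  have t: "2 * l0 < int t * g i" "int t * g i \<le> 3 * l0"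
  proof -
    have "int t = 2 * l0 div g i + 1" using l0 gi by (simp add: t_def pos_imp_zdiv_nonneg_iff)
    then have "int t * g i = (2 * l0 div g i) * g i + g i" by (simp add: algebra_simps)
    moreover have "2 * l0 = (2 * l0 div g i) * g i + 2 * l0 mod g i" by simp
    moreover have "0 \<le> 2 * l0 mod g i" "2 * l0 mod g i < g i" using gi by auto
    ultimately show "2 * l0 < int t * g i" "int t * g i \<le> 3 * l0" using l0 by linarith+
  qed
  have tk: "\<bar>int t * g k\<bar> \<le> 3 * l0" for k
  proof -
    have "\<bar>int t * g k\<bar> \<le> int t * g i" using gi(2)[of k] by (simp add: abs_mult mult_left_mono)
    then show ?thesis using t by linarith
  qed
  have shift: "per n 0 (u \<boxplus> (\<lambda>k. int m * g k)) = per n 0 u" for n u m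
  proof (induction m)
    case (Suc m)
    have "u \<boxplus> (\<lambda>k. int (Suc m) * g k) = (u \<boxplus> (\<lambda>k. int m * g k)) \<boxplus> g"
      by (simp add: fun_eq_iff vadd_apply algebra_simps)
    then show ?case using per Suc by simp
  qed simp
  have c2: "cell (Suc (Suc p)) s = (\<lambda>k. if k = i then 5 else 4)"
    using l0 l1 l2 q_large[of "Suc (Suc p)"]
    by (intro cell_decompose[where a = "\<lambda>_. 0" and r = "\<lambda>k. if k = i then 2 * l0 else 5 * l1 + 2 * l0"])
      (auto simp: s_def l2_def[symmetric] simp del: L.simps)
  have c1: "cell (Suc p) s = (\<lambda>k. if k = i then 0 else 5)"
    using l0 l1 l2 q_large[of "Suc p"]
    by (intro cell_decompose[where a = "\<lambda>k. if k = i then 5 else 4" and r = "\<lambda>k. 2 * l0"])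
      (auto simp: s_def l2_def[symmetric] l1_def[symmetric] simp del: L.simps)
  have l21: "l2 = l1 * q (Suc p)" by (simp add: l1_def l2_def)
  have c0: "cell p s = (\<lambda>k. 2)"
    using l0 l1 l2 q_large[of "p"]
    by (intro cell_decompose[where a = "\<lambda>k. if k = i then 5 * q (Suc p) else 4 * q (Suc p) + 5" and r = "\<lambda>k. 0"])
      (auto simp: s_def l21 l1_def[symmetric] l0_def[symmetric] algebra_simps simp del: L.simps)
  have "per (Suc (Suc (Suc p))) 0 s = per (Suc (Suc p)) 0 s"
  proof (rule per_Suc_generic)
    show "cell (Suc (Suc p)) s \<noteq> diag k" for k
    proof
      assume "cell (Suc (Suc p)) s = diag k"
      from fun_cong[OF this, of i] have "5 = 2 * int k + 4" by (simp add: c2 diag_def)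
      then show False by presburger
    qed
    show "cell (Suc (Suc p)) s \<noteq> (\<lambda>_. 2)" using fun_cong[of _ _ i] by (fastforce simp: c2)
  qed
  also have "\<dots> = per (Suc p) 0 s"
  proof (rule per_Suc_generic)
    show "cell (Suc p) s \<noteq> diag k" for k
    proof
      assume "cell (Suc p) s = diag k"
      from fun_cong[OF this, of i] show False by (simp add: c1 diag_def)
    qed
    show "cell (Suc p) s \<noteq> (\<lambda>_. 2)" using fun_cong[of _ _ i] by (fastforce simp: c1)
  qed
  also have "\<dots> = per p 1 s" by (rule per_Suc_two[OF c0])
  also have "\<dots> = per p 1 (\<lambda>_. 0)"
  proof (rule per_cong)
    have "l0 dvd s k" for k by (auto simp: s_def l21 l1_def l0_def)
    then show "s k mod L p = 0 mod L p" for k by (simp add: l0_def)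
  qed
  also have "\<dots> = 1" by (rule per_one_zero)
  finally have one: "per (Suc (Suc (Suc p))) 0 s = 1" .
  have "cell (Suc (Suc p)) (s \<boxminus> (\<lambda>k. int t * g k)) = diag 0"
  proof (rule cell_eqI)
    fix k
    show "diag 0 k * L (Suc (Suc p)) \<le> (s \<boxminus> (\<lambda>k. int t * g k)) k"
      "(s \<boxminus> (\<lambda>k. int t * g k)) k < (diag 0 k + 1) * L (Suc (Suc p))"
      using tk[of k] t l0 l1 l2 
      by (auto simp: diag_def s_def vminus_apply l2_def[symmetric] simp del: L.simps)
  qed (use q_large[of "Suc (Suc p)"] in \<open>auto simp: diag_def\<close>)
  then have "per (Suc (Suc (Suc p))) 0 (s \<boxminus> (\<lambda>k. int t * g k)) = 0"
    by (subst per_Suc_diag) auto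
  then show False using shift[of "Suc (Suc (Suc p))" "s \<boxminus> (\<lambda>k. int t * g k)" t] one by simp
qed

lemma faithful_X: "faithful_action X"
  unfolding faithful_action_def
proof (intro allI impI, rule ccontr)
  fix g assume g: "\<forall>x\<in>X. zd_shift g x = x" "g \<noteq> (\<lambda>_. 0)"
  have per: "per n 0 (u \<boxplus> g) = per n 0 u" for n u
    using bspec[OF g(1) per_in_X[of n "\<lambda>_. 0"]] by (simp add: zd_shift_eq fun_eq_iff)
  \<comment> \<open>\<open>no_period\<close> needs a coordinate of largest absolute value that is
    positive; if it is negative, the period \<open>- g\<close> is used instead.\<close>
  have "Max (range (\<lambda>k. \<bar>g k\<bar>)) \<in> range (\<lambda>k. \<bar>g k\<bar>)" by (intro Max_in) auto
  then obtain i where "Max (range (\<lambda>k. \<bar>g k\<bar>)) = \<bar>g i\<bar>" by (rule rangeE)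
  then have i: "\<bar>g k\<bar> \<le> \<bar>g i\<bar>" for k using Max_ge[of "range (\<lambda>k. \<bar>g k\<bar>)" "\<bar>g k\<bar>"] by auto
  obtain k where "g k \<noteq> 0" using g(2) by auto
  then have "g i \<noteq> 0" using i[of k] by auto
  then consider "0 < g i" | "g i < 0" by linarith
  then show False
  proof cases
    case 1
    then show ?thesis using no_period[of g i] per i by simp
  next
    case 2
    have "per n 0 (u \<boxplus> (\<lambda>k. - g k)) = per n 0 u" for n u
      using per[of n "u \<boxplus> (\<lambda>k. - g k)"] by (simp add: vadd_def)
    then show ?thesis using no_period[of "\<lambda>k. - g k" i] 2 i by simp
  qed
qed

lemma cam_X: "chaotic_almost_minimal X"
  unfolding chaotic_almost_minimal_def
  using transitive_X faithful_X periodic_dense finite_of_proper by blast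

section \<open>The odometer\<close>

definition digits :: "nat \<Rightarrow> ('n \<Rightarrow> int) set" where
  "digits n = {c. \<forall>i. 0 \<le> c i \<and> c i < q n}"

text \<open>Independent uniform mixed radix digits: Haar measure on the inverse limit of the groups
  of residues modulo \<open>L n\<close>, in each of the \<open>CARD('n)\<close> coordinates.\<close>

definition Om :: "(nat \<Rightarrow> 'n \<Rightarrow> int) measure" where
  "Om = PiM UNIV (\<lambda>n. uniform_count_measure (digits n))"

definition pos :: "nat \<Rightarrow> (nat \<Rightarrow> 'n \<Rightarrow> int) \<Rightarrow> 'n \<Rightarrow> int" where
  "pos n \<omega> = (\<lambda>i. \<Sum>k<n. \<omega> k i * L k)"

text \<open>Addition of the integer vector \<open>v\<close> in the odometer. Digit \<open>k\<close>
  is read off the sum modulo \<open>L (Suc k)\<close>, which takes care of the carries.\<close>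

definition odo :: "('n \<Rightarrow> int) \<Rightarrow> (nat \<Rightarrow> 'n \<Rightarrow> int) \<Rightarrow> nat \<Rightarrow> 'n \<Rightarrow> int" where
  "odo v \<omega> = (\<lambda>k i. (pos (Suc k) \<omega> i + v i) mod L (Suc k) div L k)"

lemma finite_digits: "finite (digits n)"
  unfolding digits_def by (rule finite_int_box)

lemma zero_in_digits: "(\<lambda>_. 0) \<in> digits n"
  by (simp add: digits_def q_pos)

sublocale digit_space: product_prob_space "\<lambda>n. uniform_count_measure (digits n)" "UNIV :: nat set"
proof -
  interpret prob_space "uniform_count_measure (digits n)" for n
    using finite_digits zero_in_digits by (intro prob_space_uniform_count_measure) auto
  show "product_prob_space (\<lambda>n. uniform_count_measure (digits n))" ..
qed

sublocale Om: prob_space Om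
  unfolding Om_def using finite_digits zero_in_digits
  by (intro prob_space_PiM prob_space_uniform_count_measure) auto

lemma space_Om: "space Om = {\<omega>. \<forall>n. \<omega> n \<in> digits n}"
  by (auto simp: Om_def space_PiM space_uniform_count_measure PiE_def Pi_def)

lemma pos_0 [simp]: "pos 0 \<omega> = (\<lambda>_. 0)"
  by (simp add: pos_def)

lemma pos_Suc: "pos (Suc n) \<omega> i = pos n \<omega> i + L n * \<omega> n i"
  by (simp add: pos_def mult.commute)

lemma pos_range:
  assumes "\<omega> \<in> space Om"
  shows "0 \<le> pos n \<omega> i \<and> pos n \<omega> i < L n"
proof (induction n)
  case (Suc n)
  have "\<omega> n \<in> digits n" using assms by (simp add: space_Om)
  then have "0 \<le> \<omega> n i" "\<omega> n i < q n" unfolding digits_def by blast+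
  then have "0 \<le> \<omega> n i" "\<omega> n i + 1 \<le> q n" by linarith+
  then have "0 \<le> L n * \<omega> n i" "L n * (\<omega> n i + 1) \<le> L n * q n" by simp_all
  then show ?case using Suc unfolding pos_Suc distrib_left by simp
qed simp

lemma pos_mod:
  assumes "\<omega> \<in> space Om" "n \<le> m"
  shows "pos m \<omega> i mod L n = pos n \<omega> i"
  using assms(2)
proof (induction m rule: dec_induct)
  case base
  then show ?case using pos_range[OF assms(1)] by (simp add: mod_pos_pos_trivial)
next
  case (step m)
  have "L n dvd L m * \<omega> m i" using L_dvd[OF step(1)] by simp
  then have "(pos m \<omega> i + L m * \<omega> m i) mod L n = pos m \<omega> i mod L n"
    by (auto elim!: dvdE)
  then show ?case using step by (simp add: pos_Suc)
qed

lemma cell_pos: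
  assumes "\<omega> \<in> space Om" "k < n"
  shows "cell k (pos n \<omega>) = \<omega> k"
proof -
  have "cell k (pos n \<omega>) = cell k (pos (Suc k) \<omega>)"
  proof -
    have "L (Suc k) dvd pos n \<omega> i - pos (Suc k) \<omega> i" for i
      using pos_mod[OF assms(1), of "Suc k" n i] assms(2) pos_range[OF assms(1), of "Suc k" i]
      by (metis Suc_leI mod_eq_dvd_iff mod_mod_trivial)
    then have "cell k (pos (Suc k) \<omega> \<boxplus> (pos n \<omega> \<boxminus> pos (Suc k) \<omega>)) = cell k (pos (Suc k) \<omega>)"
      by (intro cell_periodic) (simp add: vminus_apply del: L.simps)
    then show ?thesis by simp
  qed
  also have "\<dots> = \<omega> k"
    using pos_range[OF assms(1), of k] assms(1)
    by (intro cell_decompose[where a = "\<lambda>_. 0" and r = "pos k \<omega>"])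
      (auto simp: pos_Suc space_Om digits_def)
  finally show ?thesis .
qed

lemma pos_eq_iff:
  assumes "\<omega> \<in> space Om" "\<And>i. 0 \<le> c i \<and> c i < L n"
  shows "pos n \<omega> = c \<longleftrightarrow> (\<forall>k<n. \<omega> k = cell k c)"
proof
  assume "\<forall>k<n. \<omega> k = cell k c"
  then have "pos n \<omega> i = c i mod L n" for i
  proof (induction n)
    case (Suc n)
    then have "pos n \<omega> i = c i mod L n" "\<omega> n = cell n c" by auto
    then show ?case using q_pos[of n] by (simp add: pos_Suc cell_def zmod_zmult2_eq)
  qed simp
  then show "pos n \<omega> = c" using assms(2) by (auto simp: mod_pos_pos_trivial)
qed (use cell_pos[OF assms(1)] in auto)

section \<open>Cylinders and the product measure\<close>

definition pos_cyl :: "nat \<Rightarrow> ('n \<Rightarrow> int) \<Rightarrow> (nat \<Rightarrow> 'n \<Rightarrow> int) set" where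
  "pos_cyl n c = {\<omega> \<in> space Om. pos n \<omega> = c}"

lemma pos_cyl_outside:
  assumes "\<not> (\<forall>i. 0 \<le> c i \<and> c i < L n)"
  shows "pos_cyl n c = {}"
  using assms pos_range by (auto simp: pos_cyl_def)

lemma pos_cyl_inside:
  assumes "\<forall>i. 0 \<le> c i \<and> c i < L n"
  shows "pos_cyl n c = {\<omega> \<in> space Om. \<forall>k\<in>{..<n}. \<omega> k \<in> {cell k c}}"
proof -
  have "pos n \<omega> = c \<longleftrightarrow> (\<forall>k<n. \<omega> k = cell k c)" if "\<omega> \<in> space Om" for \<omega>
    using pos_eq_iff[of \<omega> c n] that assms by simp
  then show ?thesis unfolding pos_cyl_def by auto
qed

lemma cell_in_digits: "cell k c \<in> digits k"
  using q_pos[of k] by (simp add: cell_def digits_def)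

lemma pos_cyl_sets [measurable]: "pos_cyl n c \<in> sets Om"
proof (cases "\<forall>i. 0 \<le> c i \<and> c i < L n")
  case True
  have "{\<omega> \<in> space Om. \<forall>k\<in>{..<n}. \<omega> k \<in> {cell k c}} = space Om \<inter> (\<Inter>k\<in>{..<n}. {\<omega> \<in> space Om. \<omega> k \<in> {cell k c}})"
    by auto
  also have "\<dots> \<in> sets Om"
  proof (cases "n = 0")
    case False
    have "{\<omega> \<in> space Om. \<omega> k \<in> {cell k c}} \<in> sets Om" for k
      unfolding Om_def by (rule sets_Collect_single) (auto simp: sets_uniform_count_measure cell_in_digits)
    then show ?thesis using False by (intro sets.Int sets.finite_INT) auto
  qed simp
  finally show ?thesis using True by (simp add: pos_cyl_inside)
qed (simp add: pos_cyl_outside)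

lemma emeasure_pos_cyl:
  assumes "\<forall>i. 0 \<le> c i \<and> c i < L n"
  shows "emeasure Om (pos_cyl n c) = (\<Prod>k<n. ennreal (1 / card (digits k)))"
proof -
  have "emeasure Om (pos_cyl n c) = (\<Prod>k<n. emeasure (uniform_count_measure (digits k)) {cell k c})"
    unfolding pos_cyl_inside[OF assms] unfolding Om_def
    by (rule digit_space.emeasure_PiM_Collect)
      (auto simp: sets_uniform_count_measure cell_in_digits)
  also have "\<dots> = (\<Prod>k<n. ennreal (1 / card (digits k)))"
    using cell_in_digits finite_digits by (intro prod.cong) (auto simp: emeasure_uniform_count_measure)
  finally show ?thesis .
qed

definition cyls :: "(nat \<Rightarrow> 'n \<Rightarrow> int) set set" where
  "cyls = insert {} (range (\<lambda>(n, c). pos_cyl n c))"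

lemma cyls_Pow: "cyls \<subseteq> Pow (space Om)"
  by (auto simp: cyls_def pos_cyl_def)

text \<open>The residue modulo \<open>L m\<close> determines the residue modulo \<open>L n\<close>
  for \<open>n \<le> m\<close>, so two cylinders are nested or disjoint.\<close>

lemma Int_stable_cyls: "Int_stable cyls"
proof -
  have *: "pos_cyl n c \<inter> pos_cyl m c' \<in> cyls" if "n \<le> m" for n m c c'
  proof (cases "(\<lambda>i. c' i mod L n) = c")
    case True
    then have "pos_cyl n c \<inter> pos_cyl m c' = pos_cyl m c'"
      using pos_mod[OF _ that] by (fastforce simp: pos_cyl_def)
    then show ?thesis by (auto simp: cyls_def)
  next
    case False
    then have "pos_cyl n c \<inter> pos_cyl m c' = {}"
      using pos_mod[OF _ that] by (fastforce simp: pos_cyl_def)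
    then show ?thesis by (auto simp: cyls_def)
  qed
  show ?thesis
  proof (rule Int_stableI)
    fix A B assume "A \<in> cyls" "B \<in> cyls"
    then consider "A = {} \<or> B = {}" | n c m c' where "A = pos_cyl n c" "B = pos_cyl m c'"
      by (auto simp: cyls_def)
    then show "A \<inter> B \<in> cyls"
    proof cases
      case 2
      then show ?thesis using *[of n m c c'] *[of m n c' c] by (metis Int_commute nat_le_linear)
    qed (auto simp: cyls_def)
  qed
qed

lemma sets_Om: "sets Om = sigma_sets (space Om) cyls"
proof
  let ?S = "sigma (space Om) cyls"
  have S: "sets ?S = sigma_sets (space Om) cyls" using cyls_Pow by simp
  have "sets Om = sigma_sets (space Om) {{\<omega> \<in> space Om. \<omega> k \<in> A} |k A. A \<subseteq> digits k}"
    using sets_PiM_single[of "UNIV :: nat set" "\<lambda>n. uniform_count_measure (digits n)"]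
    by (simp add: Om_def space_PiM sets_uniform_count_measure)
  also have "\<dots> \<subseteq> sigma_sets (space Om) cyls"
  proof (rule sigma_sets_mono, safe)
    fix k A
    \<comment> \<open>Digit \<open>k\<close> is a function of \<open>pos (Suc k)\<close>, which
      takes countably many values.\<close>
    have "{\<omega> \<in> space Om. \<omega> k \<in> A} = (\<Union>c\<in>{c. cell k c \<in> A}. pos_cyl (Suc k) c)"
      using cell_pos[of _ k "Suc k"] by (auto simp: pos_cyl_def)
    also have "\<dots> \<in> sets ?S"
      using cyls_Pow by (intro sets.countable_UN') (auto simp: cyls_def intro!: sigma_sets.Basic)
    finally show "{\<omega> \<in> space Om. \<omega> k \<in> A} \<in> sigma_sets (space Om) cyls" using S by simp
  qed
  finally show "sets Om \<subseteq> sigma_sets (space Om) cyls" .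
  show "sigma_sets (space Om) cyls \<subseteq> sets Om"
    by (rule sets.sigma_sets_subset) (auto simp: cyls_def)
qed

lemma measure_eq_on_cyls:
  assumes "sets N1 = sets Om" "sets N2 = sets Om" "emeasure N1 (space Om) \<noteq> \<infinity>"
    and eq: "\<And>n c. \<forall>i. 0 \<le> c i \<and> c i < L n \<Longrightarrow> emeasure N1 (pos_cyl n c) = emeasure N2 (pos_cyl n c)"
  shows "N1 = N2"
proof (rule measure_eqI_generator_eq[OF Int_stable_cyls cyls_Pow, where A = "\<lambda>_. space Om"])
  show "emeasure N1 Y = emeasure N2 Y" if "Y \<in> cyls" for Y
  proof -
    have "emeasure N1 (pos_cyl n c) = emeasure N2 (pos_cyl n c)" for n c
      by (cases "\<forall>i. 0 \<le> c i \<and> c i < L n") (auto simp: eq pos_cyl_outside)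
    then show ?thesis using that by (auto simp: cyls_def)
  qed
  have "space Om = pos_cyl 0 (\<lambda>_. 0)" by (auto simp: pos_cyl_def)
  then show "range (\<lambda>_. space Om) \<subseteq> cyls" by (auto simp: cyls_def)
qed (use assms(1-3) in \<open>simp_all add: sets_Om\<close>)

lemma pos_measurable: "pos n \<in> measurable Om (count_space UNIV)"
proof (subst measurable_count_space_eq2_countable)
  have "pos n -` {c} \<inter> space Om = pos_cyl n c" for c by (auto simp: pos_cyl_def)
  then show "pos n \<in> space Om \<rightarrow> UNIV \<and> (\<forall>c\<in>UNIV. pos n -` {c} \<inter> space Om \<in> sets Om)" by simp
qed

section \<open>Translations of the odometer, invariance and ergodicity\<close>

lemma odo_in_space: "odo v \<omega> \<in> space Om"
proof -
  have "0 \<le> x mod L (Suc k) div L k \<and> x mod L (Suc k) div L k < q k" for x k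
    using q_pos[of k] by (simp add: zmod_zmult2_eq div_pos_pos_trivial)
  then show ?thesis by (simp add: space_Om digits_def odo_def del: L.simps)
qed

lemma pos_odo:
  assumes "\<omega> \<in> space Om"
  shows "pos n (odo v \<omega>) i = (pos n \<omega> i + v i) mod L n"
proof (induction n)
  case (Suc n)
  let ?x = "pos (Suc n) \<omega> i + v i"
  have "?x mod L (Suc n) mod L n = ?x mod L n" by (rule mod_mod_cancel) simp
  also have "\<dots> = (pos n \<omega> i + v i) mod L n"
    using pos_mod[OF assms, of n "Suc n" i] by (metis le_SucI mod_add_left_eq order_refl)
  finally have "?x mod L (Suc n) mod L n = pos n (odo v \<omega>) i" using Suc by simp
  moreover have "odo v \<omega> n i = ?x mod L (Suc n) div L n" by (simp add: odo_def)
  ultimately show ?case unfolding pos_Suc[of n "odo v \<omega>"] by (metis add.commute mult_div_mod_eq)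
qed simp

lemma odo_vimage_cyl:
  assumes "\<forall>i. 0 \<le> c i \<and> c i < L n"
  shows "odo v -` pos_cyl n c \<inter> space Om = pos_cyl n (\<lambda>i. (c i - v i) mod L n)"
proof -
  have "pos n (odo v \<omega>) = c \<longleftrightarrow> pos n \<omega> = (\<lambda>i. (c i - v i) mod L n)" if \<omega>: "\<omega> \<in> space Om" for \<omega>
  proof -
    have "(pos n \<omega> i + v i) mod L n = c i \<longleftrightarrow> pos n \<omega> i = (c i - v i) mod L n" for i
    proof -
      have "c i = c i mod L n" "pos n \<omega> i = pos n \<omega> i mod L n"
        using assms pos_range[OF \<omega>, of n i] by (simp_all add: mod_pos_pos_trivial)
      moreover have "(pos n \<omega> i + v i) mod L n = c i mod L n \<longleftrightarrow> pos n \<omega> i mod L n = (c i - v i) mod L n"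
        by (simp add: mod_eq_dvd_iff algebra_simps)
      ultimately show ?thesis by metis
    qed
    then show ?thesis by (simp add: fun_eq_iff pos_odo[OF \<omega>])
  qed
  then show ?thesis using odo_in_space by (auto simp: pos_cyl_def)
qed

lemma odo_measurable [measurable]: "odo v \<in> measurable Om Om"
proof (rule measurable_sigma_sets[OF sets_Om cyls_Pow])
  have "odo v -` pos_cyl n c \<inter> space Om \<in> sets Om" for n c
    by (cases "\<forall>i. 0 \<le> c i \<and> c i < L n") (auto simp: odo_vimage_cyl pos_cyl_outside)
  then show "odo v -` Y \<inter> space Om \<in> sets Om" if "Y \<in> cyls" for Y
    using that by (auto simp: cyls_def)
qed (use odo_in_space in auto)

text \<open>Translation permutes the cylinders of each level, and these all have the same
  mass.\<close>

lemma distr_odo: "distr Om Om (odo v) = Om"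
proof (rule measure_eq_on_cyls)
  fix n and c :: "'n \<Rightarrow> int" assume c: "\<forall>i. 0 \<le> c i \<and> c i < L n"
  show "emeasure (distr Om Om (odo v)) (pos_cyl n c) = emeasure Om (pos_cyl n c)"
    by (simp add: emeasure_distr odo_vimage_cyl[OF c] emeasure_pos_cyl c)
qed (simp_all add: emeasure_distr odo_in_space Om.emeasure_finite)

lemma emeasure_odo: "A \<in> sets Om \<Longrightarrow> emeasure Om (odo v -` A \<inter> space Om) = emeasure Om A"
  by (metis distr_odo emeasure_distr odo_measurable)

text \<open>The translations act transitively on the cylinders of one level, so an invariant set
  meets all of them in equal mass. Hence it is independent of every cylinder.\<close>

lemma odo_ergodic:
  assumes A: "A \<in> sets Om" and inv: "\<And>v. odo v -` A \<inter> space Om = A"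
  shows "emeasure Om A = 0 \<or> emeasure Om A = 1"
proof -
  have const: "emeasure Om (B \<inter> pos_cyl n c) = emeasure Om (B \<inter> pos_cyl n (\<lambda>_. 0))"
    if "B \<in> sets Om" "\<And>v. odo v -` B \<inter> space Om = B" "\<forall>i. 0 \<le> c i \<and> c i < L n" for B n c
  proof -
    have "emeasure Om (B \<inter> pos_cyl n c) = emeasure Om (odo c -` (B \<inter> pos_cyl n c) \<inter> space Om)"
      using that by (intro emeasure_odo[symmetric]) auto
    also have "odo c -` (B \<inter> pos_cyl n c) \<inter> space Om = (odo c -` B \<inter> space Om) \<inter> (odo c -` pos_cyl n c \<inter> space Om)"
      by auto
    also have "\<dots> = B \<inter> pos_cyl n (\<lambda>_. 0)" using that by (simp add: odo_vimage_cyl)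
    finally show ?thesis .
  qed
  have prod: "emeasure Om (A \<inter> pos_cyl n c) = emeasure Om A * emeasure Om (pos_cyl n c)"
    if c: "\<forall>i. 0 \<le> c i \<and> c i < L n" for n c
  proof -
    let ?B = "{c. \<forall>i. 0 \<le> c i \<and> c i < L n} :: ('n \<Rightarrow> int) set"
    have fin: "finite ?B" by (rule finite_int_box)
    \<comment> \<open>Used for \<open>A\<close> and for the whole space; comparing the two
      eliminates the number of cylinders.\<close>
    have split: "emeasure Om B = of_nat (card ?B) * emeasure Om (B \<inter> pos_cyl n c)"
      if "B \<in> sets Om" "\<And>v. odo v -` B \<inter> space Om = B" for B
    proof -
      have "B = (\<Union>c\<in>?B. B \<inter> pos_cyl n c)"
        using sets.sets_into_space[OF that(1)] pos_range by (auto simp: pos_cyl_def)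
      then have "emeasure Om B = emeasure Om (\<Union>c\<in>?B. B \<inter> pos_cyl n c)" by (rule arg_cong)
      also have "\<dots> = (\<Sum>c\<in>?B. emeasure Om (B \<inter> pos_cyl n c))"
      proof (intro sum_emeasure[symmetric] fin)
        show "(\<lambda>c. B \<inter> pos_cyl n c) ` ?B \<subseteq> sets Om" using that(1) by auto
      qed (auto simp: disjoint_family_on_def pos_cyl_def)
      also have "\<dots> = (\<Sum>c'\<in>?B. emeasure Om (B \<inter> pos_cyl n c))"
      proof (intro sum.cong refl)
        fix c' assume "c' \<in> ?B"
        then show "emeasure Om (B \<inter> pos_cyl n c') = emeasure Om (B \<inter> pos_cyl n c)"
          using trans[OF const[OF that, of c' n] const[OF that c, symmetric]] by blast
      qed
      finally show ?thesis by simp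
    qed
    have *: "space Om \<inter> pos_cyl n c = pos_cyl n c" by (auto simp: pos_cyl_def)
    have one: "1 = of_nat (card ?B) * emeasure Om (pos_cyl n c)"
    proof -
      have "odo v -` space Om \<inter> space Om = space Om" for v using odo_in_space by auto
      from split[OF sets.top this] show ?thesis by (simp add: * Om.emeasure_space_1)
    qed
    have "emeasure Om A * emeasure Om (pos_cyl n c) =
      (of_nat (card ?B) * emeasure Om (A \<inter> pos_cyl n c)) * emeasure Om (pos_cyl n c)"
      by (subst split[OF A inv]) (rule refl)
    also have "\<dots> = emeasure Om (A \<inter> pos_cyl n c) * (of_nat (card ?B) * emeasure Om (pos_cyl n c))"
      by (simp add: mult_ac)
    finally show ?thesis by (simp flip: one)
  qed
  \<comment> \<open>So \<open>A\<close> is independent of every event, in particular of itself.\<close>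
  have "density Om (indicator A) = scale_measure (emeasure Om A) Om"
  proof (rule measure_eq_on_cyls)
    show "emeasure (density Om (indicator A)) (pos_cyl n c) = emeasure (scale_measure (emeasure Om A) Om) (pos_cyl n c)"
      if "\<forall>i. 0 \<le> c i \<and> c i < L n" for n c
      using prod[OF that] A by (simp add: emeasure_restricted)
    show "emeasure (density Om (indicator A)) (space Om) \<noteq> \<infinity>"
      using A by (simp add: emeasure_restricted Om.emeasure_finite)
  qed auto
  then have "emeasure (density Om (indicator A)) A = emeasure (scale_measure (emeasure Om A) Om) A" by simp
  then have "emeasure Om A = emeasure Om A * emeasure Om A"
    using A by (simp add: emeasure_restricted)
  then have "Om.prob A = Om.prob A * Om.prob A"
    by (simp add: Om.emeasure_eq_measure flip: ennreal_mult)
  then have "Om.prob A = 0 \<or> Om.prob A = 1" by (simp add: algebra_simps)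
  then show ?thesis by (auto simp: Om.emeasure_eq_measure)
qed

section \<open>Coding the odometer into the system\<close>

lemma shift_in_X: "x \<in> X \<Longrightarrow> zd_shift v x \<in> X"
  using subshift_X by (auto simp: subshift_def shift_invariant_def)

lemma zd_shift_inverse: "zd_shift (\<lambda>i. - v i) (zd_shift v x) = x" "zd_shift v (zd_shift (\<lambda>i. - v i) x) = x"
  by (simp_all add: zd_shift_def)

lemma shift_in_X_iff: "zd_shift v x \<in> X \<longleftrightarrow> x \<in> X"
  using shift_in_X[of x v] shift_in_X[of "zd_shift v x" "\<lambda>i. - v i"] by (auto simp: zd_shift_inverse)

lemma zero_in_X: "(\<lambda>_. 0) \<in> X"
  using per_in_X[of 0 "\<lambda>_. 0"] by simp

text \<open>The limit of the symbols seen from \<open>pos n \<omega>\<close>, made total: 0 is the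
  value unless the symbols are eventually 1.\<close>

definition coding0 :: "nat \<Rightarrow> (nat \<Rightarrow> 'n \<Rightarrow> int) \<Rightarrow> ('n \<Rightarrow> int) \<Rightarrow> nat" where
  "coding0 a \<omega> = (\<lambda>u. if \<forall>\<^sub>F n in sequentially. per n a (pos n \<omega> \<boxplus> u) = 1 then 1 else 0)"

text \<open>The fallback value lies in \<open>X\<close> and is shift invariant, so \<open>coding\<close> is equivariant everywhere
  and not just almost everywhere.\<close>
definition coding :: "nat \<Rightarrow> (nat \<Rightarrow> 'n \<Rightarrow> int) \<Rightarrow> ('n \<Rightarrow> int) \<Rightarrow> nat" where
  "coding a \<omega> = (if coding0 a \<omega> \<in> X then coding0 a \<omega> else (\<lambda>_. 0))"

lemma coding_in_X: "coding a \<omega> \<in> X"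
  by (simp add: coding_def zero_in_X)

text \<open>\<open>pos n\<close> of the translated point agrees with the translated
  \<open>pos n\<close> modulo \<open>L n\<close>, which is a period of \<open>per n a\<close>. So
  the two sequences of symbols coincide term by term.\<close>

lemma coding0_odo:
  assumes "\<omega> \<in> space Om"
  shows "coding0 a (odo v \<omega>) = zd_shift v (coding0 a \<omega>)"
proof -
  have "per n a (pos n (odo v \<omega>) \<boxplus> u) = per n a (pos n \<omega> \<boxplus> (u \<boxplus> v))" for n u
    by (rule per_cong) (simp add: vadd_apply pos_odo[OF assms] mod_simps add_ac)
  then show ?thesis by (simp add: coding0_def zd_shift_eq)
qed

lemma coding_odo: "\<omega> \<in> space Om \<Longrightarrow> coding a (odo v \<omega>) = zd_shift v (coding a \<omega>)"
  by (simp add: coding_def coding0_odo shift_in_X_iff) (simp add: zd_shift_def)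

lemma coding0_pred: "Measurable.pred Om (\<lambda>\<omega>. coding0 a \<omega> u = k)"
proof -
  have [measurable]: "Measurable.pred Om (\<lambda>\<omega>. per n a (pos n \<omega> \<boxplus> u) = 1)" for n
    by (rule measurable_compose[OF pos_measurable]) simp
  have *: "coding0 a \<omega> u = k \<longleftrightarrow> (k = 1 \<and> (\<exists>N. \<forall>n\<ge>N. per n a (pos n \<omega> \<boxplus> u) = 1)) \<or>
      (k = 0 \<and> \<not> (\<exists>N. \<forall>n\<ge>N. per n a (pos n \<omega> \<boxplus> u) = 1))" for \<omega>
    by (auto simp: coding0_def eventually_sequentially)
  show ?thesis unfolding * by measurable
qed

lemma coding0_in_X_pred: "Measurable.pred Om (\<lambda>\<omega>. coding0 a \<omega> \<in> X)"
  unfolding X_def mem_Collect_eq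
  by (intro pred_intros_countable pred_intros_finite finite_window coding0_pred)

lemma coding_pred: "Measurable.pred Om (\<lambda>\<omega>. coding a \<omega> u = k)"
proof -
  note [measurable] = coding0_pred coding0_in_X_pred
  have *: "coding a \<omega> u = k \<longleftrightarrow> (coding0 a \<omega> \<in> X \<and> coding0 a \<omega> u = k) \<or> (coding0 a \<omega> \<notin> X \<and> k = 0)" for \<omega>
    by (auto simp: coding_def)
  show ?thesis unfolding * by measurable
qed

section \<open>The push-forward measures on the system\<close>

definition Bor :: "(('n \<Rightarrow> int) \<Rightarrow> nat) measure" where
  "Bor = sigma X {U. openin (subtopology full_shift_space X) U}"

definition mu :: "nat \<Rightarrow> (('n \<Rightarrow> int) \<Rightarrow> nat) measure" where
  "mu a = distr Om Bor (coding a)"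

lemma topspace_X: "topspace (subtopology full_shift_space X) = X"
  using X_le_1 by (auto simp: topspace_full_shift)

lemma open_Pow: "{U. openin (subtopology full_shift_space X) U} \<subseteq> Pow X"
  using openin_subset topspace_X by fastforce

lemma space_Bor: "space Bor = X"
  using open_Pow by (simp add: Bor_def)

lemma sets_Bor: "sets Bor = borel_sets_of (subtopology full_shift_space X)"
  unfolding Bor_def borel_sets_of_def topspace_X by (rule sets_measure_of[OF open_Pow])

lemma open_in_Bor: "openin (subtopology full_shift_space X) U \<Longrightarrow> U \<in> sets Bor"
  unfolding sets_Bor borel_sets_of_def by (auto intro: sigma_sets.Basic)

definition per_cyl :: "nat \<times> ('n \<Rightarrow> int) \<times> nat \<Rightarrow> (('n \<Rightarrow> int) \<Rightarrow> nat) set" where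
  "per_cyl t = (case t of (R, v, n) \<Rightarrow> {x \<in> X. \<forall>u\<in>window R. x u = per n 0 (u \<boxplus> v)})"

text \<open>The triples indexing \<open>per_cyl\<close> form a countable type, so these sets are a
  countable base of \<open>X\<close>, and measurability into \<open>Bor\<close> reduces to
  conditions on windows.\<close>

lemma open_eq_Union_per_cyl:
  assumes "openin (subtopology full_shift_space X) U"
  shows "U = (\<Union>t\<in>{t. per_cyl t \<subseteq> U}. per_cyl t)"
proof
  show "U \<subseteq> (\<Union>t\<in>{t. per_cyl t \<subseteq> U}. per_cyl t)"
  proof
    fix x assume x: "x \<in> U"
    then obtain R where R: "\<forall>y\<in>X. (\<forall>u\<in>window R. y u = x u) \<longrightarrow> y \<in> U" and xX: "x \<in> X"
      using assms unfolding openin_subshift[OF X_le_1] by blast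
    obtain v n where v: "\<forall>u\<in>window R. x u = per n 0 (u \<boxplus> v)" using xX by (rule X_windowE)
    have "per_cyl (R, v, n) \<subseteq> U" using R v by (auto simp: per_cyl_def)
    moreover have "x \<in> per_cyl (R, v, n)" using v xX by (simp add: per_cyl_def)
    ultimately show "x \<in> (\<Union>t\<in>{t. per_cyl t \<subseteq> U}. per_cyl t)" by auto
  qed
qed auto

lemma coding_measurable: "coding a \<in> measurable Om Bor"
  unfolding Bor_def
proof (rule measurable_measure_of[OF open_Pow])
  fix U assume "U \<in> {U. openin (subtopology full_shift_space X) U}"
  then have U: "U = (\<Union>t\<in>{t. per_cyl t \<subseteq> U}. per_cyl t)"
    using open_eq_Union_per_cyl by blast
  have "coding a -` per_cyl t \<inter> space Om \<in> sets Om" for t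
  proof (cases t)
    case (fields R v n)
    have "Measurable.pred Om (\<lambda>\<omega>. \<forall>u\<in>window R. coding a \<omega> u = per n 0 (u \<boxplus> v))"
      by (intro pred_intros_finite finite_window coding_pred)
    moreover have "coding a -` per_cyl t \<inter> space Om =
        {\<omega> \<in> space Om. \<forall>u\<in>window R. coding a \<omega> u = per n 0 (u \<boxplus> v)}"
      using coding_in_X by (auto simp: per_cyl_def fields)
    ultimately show ?thesis by (simp add: pred_def)
  qed
  then have "(\<Union>t\<in>{t. per_cyl t \<subseteq> U}. coding a -` per_cyl t \<inter> space Om) \<in> sets Om"
    by (intro sets.countable_UN') auto
  also have "(\<Union>t\<in>{t. per_cyl t \<subseteq> U}. coding a -` per_cyl t \<inter> space Om) = coding a -` U \<inter> space Om"
    by (subst (2) U) auto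
  finally show "coding a -` U \<inter> space Om \<in> sets Om" .
qed (use coding_in_X in auto)

lemma shift_measurable: "zd_shift g \<in> measurable Bor Bor"
  unfolding Bor_def
proof (rule measurable_measure_of[OF open_Pow])
  fix U assume "U \<in> {U. openin (subtopology full_shift_space X) U}"
  then have U: "U \<subseteq> X" "\<forall>x\<in>U. \<exists>R. \<forall>y\<in>X. (\<forall>u\<in>window R. y u = x u) \<longrightarrow> y \<in> U"
    unfolding openin_subshift[OF X_le_1] by auto
  have "openin (subtopology full_shift_space X) (zd_shift g -` U \<inter> X)"
    unfolding openin_subshift[OF X_le_1]
  proof (intro conjI ballI)
    fix x assume x: "x \<in> zd_shift g -` U \<inter> X"
    then have "zd_shift g x \<in> U" by simp
    from bspec[OF U(2) this] obtain R
      where R: "\<forall>y\<in>X. (\<forall>u\<in>window R. y u = zd_shift g x u) \<longrightarrow> y \<in> U" by (rule exE)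
    obtain R' where R': "(\<lambda>u. u \<boxplus> g) ` window R \<subseteq> window R'"
      using finite_subset_window finite_window by blast
    have "zd_shift g y \<in> U" if "y \<in> X" "\<forall>u\<in>window R'. y u = x u" for y
    proof -
      have "\<forall>u\<in>window R. zd_shift g y u = zd_shift g x u"
        using that(2) R' by (auto simp: zd_shift_eq)
      then show ?thesis using bspec[OF R shift_in_X[OF that(1)]] by simp
    qed
    then show "\<exists>R. \<forall>y\<in>X. (\<forall>u\<in>window R. y u = x u) \<longrightarrow> y \<in> zd_shift g -` U \<inter> X"
      by (intro exI[of _ R']) simp
  qed simp
  then have "zd_shift g -` U \<inter> X \<in> sets Bor" by (rule open_in_Bor)
  then show "zd_shift g -` U \<inter> space (sigma X {U. openin (subtopology full_shift_space X) U})
      \<in> sets (sigma X {U. openin (subtopology full_shift_space X) U})"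
    using space_Bor by (simp only: Bor_def)
qed (use shift_in_X space_Bor[unfolded Bor_def] in auto)

lemma emeasure_mu: "A \<in> sets Bor \<Longrightarrow> emeasure (mu a) A = emeasure Om (coding a -` A \<inter> space Om)"
  unfolding mu_def by (rule emeasure_distr[OF coding_measurable])

lemma sets_mu: "sets (mu a) = sets Bor" and space_mu: "space (mu a) = X"
  by (simp_all add: mu_def space_Bor)

lemma prob_mu: "prob_space (mu a)"
  unfolding mu_def by (rule Om.prob_space_distr[OF coding_measurable])

lemma shift_vimage_sets: "A \<in> sets Bor \<Longrightarrow> zd_shift g -` A \<inter> X \<in> sets Bor"
  using measurable_sets[OF shift_measurable] by (simp add: space_Bor)

text \<open>\<open>coding\<close> is equivariant at every point of \<open>space Om\<close>, so the
  preimages agree as sets and the invariance of \<open>Om\<close> transfers.\<close>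

lemma invariant_mu: "shift_invariant_measure X (mu a)"
  unfolding shift_invariant_measure_def borel_prob_on_def
proof (intro conjI allI ballI)
  fix g A assume "A \<in> sets (mu a)"
  then have A: "A \<in> sets Bor" by (simp add: sets_mu)
  have "coding a -` (zd_shift g -` A \<inter> X) \<inter> space Om = odo g -` (coding a -` A \<inter> space Om) \<inter> space Om"
    using coding_in_X odo_in_space by (auto simp: coding_odo)
  then show "emeasure (mu a) (zd_shift g -` A \<inter> X) = emeasure (mu a) A"
    using emeasure_odo[OF measurable_sets[OF coding_measurable A]]
    by (simp add: emeasure_mu A shift_vimage_sets)
qed (simp_all add: prob_mu space_mu sets_mu sets_Bor)

lemma ergodic_mu: "ergodic_measure X (mu a)"
  unfolding ergodic_measure_def
proof (intro conjI ballI impI invariant_mu)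
  fix A assume "A \<in> sets (mu a)" and inv: "\<forall>g. zd_shift g -` A \<inter> X = A"
  then have A: "A \<in> sets Bor" by (simp add: sets_mu)
  have shift: "zd_shift v x \<in> A \<longleftrightarrow> x \<in> A" if "x \<in> X" for v x
    using spec[OF inv, of v] that by blast
  have "odo v -` (coding a -` A \<inter> space Om) \<inter> space Om = coding a -` A \<inter> space Om" for v
    using odo_in_space shift[OF coding_in_X] by (auto simp: coding_odo)
  then show "emeasure (mu a) A = 0 \<or> emeasure (mu a) A = 1"
    unfolding emeasure_mu[OF A] by (intro odo_ergodic measurable_sets[OF coding_measurable A])
qed

section \<open>Nonatomicity and distinctness\<close>

text \<open>A digit in \<open>good n\<close> is at distance at least 2 from all exceptional cells and not in the last
  layer, so a shift by at most \<open>L n\<close> still sees the generic pattern.\<close>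
definition good :: "nat \<Rightarrow> ('n \<Rightarrow> int) set" where
  "good n = {c. \<forall>i. 2 * int n + 6 \<le> c i \<and> c i < q n - 1}"

text \<open>The shift changes each coordinate of the digit by at most one. The digit then stays
  above all exceptional heights and does not wrap into the next block.\<close>

lemma per_pos_Suc:
  assumes "\<omega> \<in> space Om" "\<omega> n \<in> good n" "\<And>i. \<bar>u i\<bar> \<le> L n"
  shows "per (Suc n) a (pos (Suc n) \<omega> \<boxplus> u) = per n a (pos n \<omega> \<boxplus> u)"
proof -
  let ?z = "pos (Suc n) \<omega> \<boxplus> u"
  have bnd: "2 * int n + 5 \<le> cell n ?z i" for i
  proof -
    have z: "?z i = L n * \<omega> n i + (pos n \<omega> i + u i)" by (simp add: vadd_apply pos_Suc)
    have s: "- L n \<le> pos n \<omega> i + u i" "pos n \<omega> i + u i < 2 * L n"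
      using pos_range[OF assms(1), of n i] assms(3)[of i] by linarith+
    have "?z i = L n * (?z i div L n) + ?z i mod L n" "0 \<le> ?z i mod L n" "?z i mod L n < L n" by simp_all
    then have "L n * (?z i div L n) < L n * (\<omega> n i + 2)" "L n * (\<omega> n i - 2) < L n * (?z i div L n)"
      using s z unfolding distrib_left right_diff_distrib by linarith+
    then have "?z i div L n < \<omega> n i + 2" "\<omega> n i - 2 < ?z i div L n"
      using L_pos[of n] by (simp_all only: mult_less_cancel_left_pos)
    moreover have "2 * int n + 6 \<le> \<omega> n i" "\<omega> n i < q n - 1"
      using assms(2) unfolding good_def by blast+
    ultimately have "2 * int n + 5 \<le> ?z i div L n" "?z i div L n < q n" by linarith+
    then show ?thesis by (simp add: cell_def mod_pos_pos_trivial)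
  qed
  have "per (Suc n) a ?z = per n a ?z"
  proof (rule per_Suc_generic)
    show "cell n ?z \<noteq> (\<lambda>_. 2)"
    proof
      assume "cell n ?z = (\<lambda>_. 2)"
      then show False using bnd by simp
    qed
    show "cell n ?z \<noteq> diag k" if "k < n" for k
    proof
      assume "cell n ?z = diag k"
      then show False using bnd that by (simp add: diag_def)
    qed
  qed
  also have "\<dots> = per n a (pos n \<omega> \<boxplus> u)"
  proof (rule per_cong)
    fix i
    have "?z i = (pos n \<omega> \<boxplus> u) i + L n * \<omega> n i" by (simp add: vadd_apply pos_Suc)
    then show "?z i mod L n = (pos n \<omega> \<boxplus> u) i mod L n" by simp
  qed
  finally show ?thesis .
qed

text \<open>From level \<open>N\<close> on no step changes the symbol, so the limit is already
  attained at level \<open>N\<close>.\<close>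

lemma coding0_eq:
  assumes "\<omega> \<in> space Om" "\<And>n. N \<le> n \<Longrightarrow> \<omega> n \<in> good n" "\<And>i. \<bar>u i\<bar> \<le> L N" "a \<le> 1"
  shows "coding0 a \<omega> u = per N a (pos N \<omega> \<boxplus> u)"
proof -
  have "per n a (pos n \<omega> \<boxplus> u) = per N a (pos N \<omega> \<boxplus> u)" if "N \<le> n" for n
    using that
  proof (induction n rule: dec_induct)
    case (step n)
    have "L N \<le> L n" using L_dvd[OF step(1)] by (simp add: zdvd_imp_le)
    then have "per (Suc n) a (pos (Suc n) \<omega> \<boxplus> u) = per n a (pos n \<omega> \<boxplus> u)"
      using assms step(1) by (intro per_pos_Suc) (auto intro: order_trans)
    then show ?case using step by simp
  qed simp
  then have "(\<forall>\<^sub>F n in sequentially. per n a (pos n \<omega> \<boxplus> u) = 1) \<longleftrightarrow> per N a (pos N \<omega> \<boxplus> u) = 1"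
    unfolding eventually_sequentially by (metis max.cobounded1 max.cobounded2)
  moreover have "per N a (pos N \<omega> \<boxplus> u) \<le> 1" using per_le_1 assms(4) .
  ultimately show ?thesis by (auto simp: coding0_def)
qed

section \<open>Windows of coded points\<close>

lemma L_large: "\<exists>m\<ge>N. K \<le> L m"
proof (intro exI[of _ "N + nat K"] conjI)
  have "K \<le> (1 + int (nat K)) * 1" by simp
  also have "\<dots> \<le> (1 + int (nat K)) * L N" using L_ge_1[of N] by (intro mult_left_mono) auto
  also have "\<dots> \<le> L (N + nat K)" by (rule L_growth)
  finally show "K \<le> L (N + nat K)" .
qed simp

text \<open>For label 0 the windows occur in \<open>per (Suc m) 0\<close> directly. For label 1 the
  window must fit inside one block of \<open>per (Suc m) 1\<close>, which then occurs as cell 2 of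
  \<open>per (Suc (Suc m)) 0\<close>.\<close>

lemma coding0_in_X:
  assumes "\<omega> \<in> space Om" "\<And>n. N \<le> n \<Longrightarrow> \<omega> n \<in> good n" "a \<le> 1"
  shows "coding0 a \<omega> \<in> X"
  unfolding X_def
proof (intro CollectI allI)
  fix R
  obtain m where m: "N \<le> m" "int R \<le> L m" using L_large by blast
  have mono: "L m \<le> L (Suc m)" using L_dvd[of m "Suc m"] by (intro zdvd_imp_le L_pos) simp
  have u: "\<bar>u i\<bar> \<le> L m" if "u \<in> window R" for u :: "'n \<Rightarrow> int" and i
    using that m(2) by (auto simp: window_def intro: order_trans)
  have eq: "coding0 a \<omega> u = per (Suc m) a (pos (Suc m) \<omega> \<boxplus> u)" if "u \<in> window R" for u
  proof (rule coding0_eq)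
    fix i show "\<bar>u i\<bar> \<le> L (Suc m)" using u[OF that, of i] mono by linarith
  qed (use assms m in auto)
  consider "a = 0" | "a = 1" using assms(3) by linarith
  then show "\<exists>v n. \<forall>u\<in>window R. coding0 a \<omega> u = per n 0 (u \<boxplus> v)"
  proof cases
    case 1
    then show ?thesis using eq
      by (intro exI[of _ "pos (Suc m) \<omega>"] exI[of _ "Suc m"]) (simp add: vadd_def add.commute)
  next
    case 2
    define v where "v = (\<lambda>i. 2 * L (Suc m) + pos (Suc m) \<omega> i)"
    have "coding0 a \<omega> u = per (Suc (Suc m)) 0 (u \<boxplus> v)" if "u \<in> window R" for u
    proof -
      \<comment> \<open>The good digit at level \<open>m\<close> keeps the position at least
        \<open>L m\<close> away from the faces of its \<open>L (Suc m)\<close>-block.\<close>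
      have rng: "0 \<le> pos (Suc m) \<omega> i + u i \<and> pos (Suc m) \<omega> i + u i < L (Suc m)" for i
      proof -
        have "\<omega> m \<in> good m" using assms(2) m(1) by simp
        then have "2 * int m + 6 \<le> \<omega> m i" "\<omega> m i < q m - 1" unfolding good_def by blast+
        then have "L m * 1 \<le> L m * \<omega> m i" "L m * \<omega> m i \<le> L m * (q m - 2)"
          by (intro mult_left_mono; simp)+
        then show ?thesis
          using u[OF that, of i] pos_range[OF assms(1), of m i]
          unfolding pos_Suc L.simps right_diff_distrib by linarith
      qed
      have "cell (Suc m) (u \<boxplus> v) = (\<lambda>_. 2)"
        using rng q_large[of "Suc m"]
        by (intro cell_eqI) (auto simp: v_def vadd_apply add.commute simp del: L.simps)
      then have "per (Suc (Suc m)) 0 (u \<boxplus> v) = per (Suc m) 1 (u \<boxplus> v)" by (rule per_Suc_two)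
      also have "\<dots> = per (Suc m) 1 (pos (Suc m) \<omega> \<boxplus> u)"
      proof (rule per_cong)
        fix i
        have "(u \<boxplus> v) i = (pos (Suc m) \<omega> \<boxplus> u) i + 2 * L (Suc m)" by (simp add: v_def vadd_apply)
        then show "(u \<boxplus> v) i mod L (Suc m) = (pos (Suc m) \<omega> \<boxplus> u) i mod L (Suc m)" by simp
      qed
      finally show ?thesis using eq[OF that] 2 by simp
    qed
    then show ?thesis by blast
  qed
qed

lemma coding0_zero_window:
  assumes "\<omega> \<in> space Om" "\<And>n. N \<le> n \<Longrightarrow> \<omega> n \<in> good n" "a \<le> 1"
  shows "\<exists>v. \<forall>u\<in>window R. coding0 a \<omega> (u \<boxplus> v) = 0"
proof -
  \<comment> \<open>\<open>L m\<close> must hold a window of radius \<open>R\<close>, and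
    \<open>m\<close> must be positive because level 0 has no cell \<open>diag 0\<close> among its
    exceptional ones.\<close>
  obtain m where m: "Suc N \<le> m" "2 * int R + 1 \<le> L m" using L_large by blast
  \<comment> \<open>Leads from the current position to the corner of cell \<open>diag 0\<close>,
    with margin \<open>R\<close>; that cell is filled with \<open>per 0 0\<close>, which is
    identically 0.\<close>
  define v where "v = (\<lambda>i. 4 * L m + int R - pos (Suc m) \<omega> i)"
  have "coding0 a \<omega> (u \<boxplus> v) = 0" if "u \<in> window R" for u
  proof -
    have u: "\<bar>u i\<bar> \<le> int R" for i using that by (simp add: window_def)
    have L5: "5 * L m \<le> L (Suc m)"
      using q_large[of m] mult_left_mono[of 5 "q m" "L m"] by simp
    have "coding0 a \<omega> (u \<boxplus> v) = per (Suc m) a (pos (Suc m) \<omega> \<boxplus> (u \<boxplus> v))"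
    proof (rule coding0_eq)
      fix i show "\<bar>(u \<boxplus> v) i\<bar> \<le> L (Suc m)"
        using u[of i] m(2) L5 pos_range[OF assms(1), of "Suc m" i] L_pos[of m]
        unfolding vadd_apply v_def by linarith
    qed (use assms m in auto)
    also have "\<dots> = per 0 0 (pos (Suc m) \<omega> \<boxplus> (u \<boxplus> v))"
    proof (rule per_Suc_diag)
      have "diag 0 i * L m \<le> (pos (Suc m) \<omega> \<boxplus> (u \<boxplus> v)) i \<and>
          (pos (Suc m) \<omega> \<boxplus> (u \<boxplus> v)) i < (diag 0 i + 1) * L m" for i
        using u[of i] m(2) by (auto simp: diag_def vadd_apply v_def)
      then show "cell m (pos (Suc m) \<omega> \<boxplus> (u \<boxplus> v)) = diag 0"
        using q_large[of m] by (intro cell_eqI) (auto simp: diag_def)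
    qed (use m in auto)
    finally show ?thesis by simp
  qed
  then show ?thesis by blast
qed

text \<open>The surrounding \<open>L (Suc N)\<close>-block has a cell 2 filled with
  \<open>per N 1\<close>, whose corner symbol is 1.\<close>

lemma coding0_one:
  assumes "\<omega> \<in> space Om" "\<And>n. N \<le> n \<Longrightarrow> \<omega> n \<in> good n" "a \<le> 1"
  shows "\<exists>u. coding0 a \<omega> u = 1"
proof -
  define z :: "'n \<Rightarrow> int" where "z = (\<lambda>_. 2 * L N)"
  have L5: "5 * L N \<le> L (Suc N)"
    using q_large[of N] mult_left_mono[of 5 "q N" "L N"] by simp
  have "coding0 a \<omega> (z \<boxminus> pos (Suc N) \<omega>) = per (Suc N) a (pos (Suc N) \<omega> \<boxplus> (z \<boxminus> pos (Suc N) \<omega>))"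
  proof (rule coding0_eq)
    fix i show "\<bar>(z \<boxminus> pos (Suc N) \<omega>) i\<bar> \<le> L (Suc N)"
      using L5 pos_range[OF assms(1), of "Suc N" i] L_pos[of N] unfolding vminus_apply z_def by linarith
  qed (use assms in auto)
  also have "\<dots> = per N 1 z"
    using q_large[of N] by (subst per_Suc_two) (auto intro!: cell_eqI simp: z_def)
  also have "\<dots> = per N 1 (\<lambda>_. 0)" by (rule per_cong) (simp add: z_def)
  also have "\<dots> = 1" by (rule per_one_zero)
  finally show ?thesis by blast
qed

section \<open>Probability of good digits\<close>

lemma card_int_box:
  "a \<le> b \<Longrightarrow> real (card {c :: 'n \<Rightarrow> int. \<forall>i. a \<le> c i \<and> c i < b}) = real_of_int (b - a) ^ CARD('n)"
proof -
  assume "a \<le> b"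
  moreover have "{c :: 'n \<Rightarrow> int. \<forall>i. a \<le> c i \<and> c i < b} = (\<Pi>\<^sub>E i\<in>UNIV. {a..<b})"
    by (auto simp: PiE_def Pi_def)
  ultimately show ?thesis by (simp add: card_PiE)
qed

definition bad :: "nat \<Rightarrow> (nat \<Rightarrow> 'n \<Rightarrow> int) set" where
  "bad n = {\<omega> \<in> space Om. \<omega> n \<in> digits n - good n}"

lemma bad_sets: "bad n \<in> sets Om"
  unfolding bad_def Om_def
  by (rule sets_Collect_single) (auto simp: sets_uniform_count_measure)

lemma prob_bad: "Om.prob (bad n) \<le> (1 / 2) ^ (n + 3)"
proof -
  have sub: "good n \<subseteq> digits n"
  proof
    fix c assume "c \<in> good n"
    then have c: "2 * int n + 6 \<le> c i" "c i < q n - 1" for i unfolding good_def by blast+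
    have "0 \<le> c i \<and> c i < q n" for i using c[of i] by linarith
    then show "c \<in> digits n" by (simp add: digits_def)
  qed
  define d Q where "d = CARD('n)" and "Q = real_of_int (q n)"
  have Q: "real d * (2 * real n + 10) * 2 ^ (n + 3) \<le> Q"
  proof -
    have "real_of_int (int CARD('n) * (2 * int n + 10) * 2 ^ (n + 3)) \<le> Q"
      unfolding Q_def using q_ge[of n] by (simp only: of_int_le_iff)
    then show ?thesis by (simp add: d_def)
  qed
  have Q10: "2 * real n + 10 \<le> Q" unfolding Q_def using q_large[of n] by linarith
  have cd: "real (card (digits n)) = Q ^ d"
    using card_int_box[of 0 "q n"] q_pos[of n] by (simp add: digits_def d_def Q_def)
  \<comment> \<open>In each coordinate the \<open>2 * n + 6\<close> lowest values and the topmost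
    one are excluded, hence \<open>2 * n + 7\<close>.\<close>
  have cg: "real (card (good n)) = (Q - (2 * real n + 7)) ^ d"
    using card_int_box[of "2 * int n + 6" "q n - 1"] q_large[of n]
    by (simp add: good_def d_def Q_def algebra_simps)
  have "emeasure Om (bad n) = emeasure (uniform_count_measure (digits n)) (digits n - good n)"
    unfolding bad_def Om_def
    by (rule digit_space.emeasure_PiM_Collect_single) (auto simp: sets_uniform_count_measure)
  then have "Om.prob (bad n) = measure (uniform_count_measure (digits n)) (digits n - good n)"
    by (simp add: measure_def)
  also have "\<dots> = real (card (digits n) - card (good n)) / real (card (digits n))"
    using sub finite_digits by (simp add: measure_uniform_count_measure card_Diff_subset finite_subset)
  also have "\<dots> = 1 - (Q - (2 * real n + 7)) ^ d / Q ^ d"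
  proof -
    have "card (good n) \<le> card (digits n)" using sub finite_digits by (rule card_mono[rotated])
    then have "real (card (digits n) - card (good n)) = Q ^ d - (Q - (2 * real n + 7)) ^ d"
      by (simp add: of_nat_diff cd cg)
    then show ?thesis using Q10 by (simp add: cd diff_divide_distrib)
  qed
  also have "\<dots> = 1 - (1 + - ((2 * real n + 7) / Q)) ^ d"
    using Q10 by (simp add: power_divide[symmetric] diff_divide_distrib)
  also have "\<dots> \<le> real d * ((2 * real n + 7) / Q)"
  proof -
    have "- 1 \<le> - ((2 * real n + 7) / Q)" using Q10 by (simp add: divide_le_eq)
    from Bernoulli_inequality[OF this, of d] show ?thesis by simp
  qed
  also have "\<dots> \<le> (1 / 2) ^ (n + 3)"
  proof -
    have "real d * (2 * real n + 7) * 2 ^ (n + 3) \<le> real d * (2 * real n + 10) * 2 ^ (n + 3)"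
      by (intro mult_right_mono mult_left_mono) auto
    then have "real d * (2 * real n + 7) * 2 ^ (n + 3) \<le> Q" using Q by linarith
    then show ?thesis using Q10 by (simp add: power_one_over divide_simps)
  qed
  finally show ?thesis .
qed

lemma not_bad: "\<omega> \<in> space Om \<Longrightarrow> \<omega> \<notin> bad n \<longleftrightarrow> \<omega> n \<in> good n"
  by (auto simp: bad_def space_Om)

lemma half_powers_sums: "(\<lambda>n. (1 / 2 :: real) ^ (n + 3)) sums (1 / 4)"
  using sums_mult[OF geometric_sums[of "1 / 2 :: real"], of "1 / 8"] by (simp add: power_add power3_eq_cube)

lemma AE_good: "AE \<omega> in Om. \<exists>N. \<forall>n\<ge>N. \<omega> n \<in> good n"
proof -
  have "summable (\<lambda>n. Om.prob (bad n))"
    using half_powers_sums[THEN sums_summable]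
    by (rule summable_comparison_test'[where N = 0]) (simp add: prob_bad)
  then have "AE \<omega> in Om. eventually (\<lambda>n. \<omega> \<in> space Om - bad n) sequentially"
    by (intro borel_cantelli_AE1 bad_sets) (simp add: Om.emeasure_finite less_top[symmetric])
  then show ?thesis
    by (rule AE_mp) (auto intro!: AE_I2 simp: eventually_sequentially not_bad)
qed

text \<open>Union bound with total 1/4. On this event the symbol at the origin equals the label,
  which separates the two measures.\<close>

lemma prob_all_good: "3 / 4 \<le> Om.prob {\<omega> \<in> space Om. \<forall>n. \<omega> n \<in> good n}"
proof -
  have sm: "summable (\<lambda>n. Om.prob (bad n))"
    using half_powers_sums[THEN sums_summable]
    by (rule summable_comparison_test'[where N = 0]) (simp add: prob_bad)
  have "Om.prob (\<Union>n. bad n) \<le> (\<Sum>n. Om.prob (bad n))"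
    using bad_sets sm by (intro Om.finite_measure_subadditive_countably) auto
  also have "\<dots> \<le> (\<Sum>n. (1 / 2) ^ (n + 3))"
    using sm half_powers_sums[THEN sums_summable] by (intro suminf_le prob_bad)
  also have "\<dots> = 1 / 4" using half_powers_sums by (simp only: sums_unique[symmetric])
  finally have "Om.prob (\<Union>n. bad n) \<le> 1 / 4" .
  moreover have "{\<omega> \<in> space Om. \<forall>n. \<omega> n \<in> good n} = space Om - (\<Union>n. bad n)"
    using not_bad by blast
  moreover have "Om.prob (space Om - (\<Union>n. bad n)) = 1 - Om.prob (\<Union>n. bad n)"
    using bad_sets by (intro Om.prob_compl) auto
  ultimately show ?thesis by simp
qed

section \<open>Comparing the two measures and excluding atoms\<close>

lemma value_sets: "{x \<in> X. x u = k} \<in> sets Bor"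
proof -
  obtain R where R: "u \<in> window R" using finite_subset_window[of "{u}"] by auto
  have "openin (subtopology full_shift_space X) {x \<in> X. x u = k}"
    unfolding openin_subshift[OF X_le_1] using R by (auto intro!: exI[of _ R])
  then show ?thesis by (rule open_in_Bor)
qed

lemma measure_value_ge:
  assumes "a \<le> 1"
  shows "3 / 4 \<le> measure (mu a) {x \<in> X. x (\<lambda>_. 0) = a}"
proof -
  let ?S = "coding a -` {x \<in> X. x (\<lambda>_. 0) = a} \<inter> space Om"
  have "\<omega> \<in> ?S" if w: "\<omega> \<in> space Om" "\<forall>n. \<omega> n \<in> good n" for \<omega>
  proof -
    have "coding a \<omega> = coding0 a \<omega>" using coding0_in_X[of \<omega> 0 a] w assms by (simp add: coding_def)
    \<comment> \<open>With all digits good the limit is attained at level 0, where the pattern is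
      constantly \<open>a\<close>.\<close>
    moreover have "coding0 a \<omega> (\<lambda>_. 0) = per 0 a (pos 0 \<omega> \<boxplus> (\<lambda>_. 0))"
      using w assms by (intro coding0_eq) auto
    ultimately show ?thesis using coding_in_X[of a \<omega>] w by simp
  qed
  then have "Om.prob {\<omega> \<in> space Om. \<forall>n. \<omega> n \<in> good n} \<le> Om.prob ?S"
    using measurable_sets[OF coding_measurable value_sets] by (intro Om.finite_measure_mono) auto
  also have "\<dots> = measure (mu a) {x \<in> X. x (\<lambda>_. 0) = a}"
    using value_sets by (simp add: measure_def emeasure_mu)
  finally show ?thesis using prob_all_good by simp
qed

text \<open>Otherwise one probability measure would give mass at least 3/4 to each of two disjoint
  events.\<close>

lemma mu_neq: "mu 0 \<noteq> mu 1"
proof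
  assume eq: "mu 0 = mu 1"
  interpret prob_space "mu 1" by (rule prob_mu)
  have "prob ({x \<in> X. x (\<lambda>_. 0) = 0} \<union> {x \<in> X. x (\<lambda>_. 0) = 1}) =
    prob {x \<in> X. x (\<lambda>_. 0) = 0} + prob {x \<in> X. x (\<lambda>_. 0) = 1}"
    by (rule finite_measure_Union) (auto simp: sets_mu value_sets)
  then have "3 / 4 + 3 / 4 \<le> prob ({x \<in> X. x (\<lambda>_. 0) = 0} \<union> {x \<in> X. x (\<lambda>_. 0) = 1})"
    using measure_value_ge[of 0] measure_value_ge[of 1] eq by simp
  then show False
    using prob_le_1[of "{x \<in> X. x (\<lambda>_. 0) = 0} \<union> {x \<in> X. x (\<lambda>_. 0) = 1}"] by linarith
qed

text \<open>An atom of an invariant probability measure has a finite orbit. It is also the code of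
  an eventually good odometer point, and such a code shows a 1 as well as arbitrarily large windows
  of zeros.\<close>

lemma nonatomic_mu:
  assumes a: "a \<le> 1"
  shows "nonatomic_measure (mu a)"
  unfolding nonatomic_measure_def space_mu
proof (rule ballI, rule ccontr)
  fix x assume x: "x \<in> X" and pos: "emeasure (mu a) {x} \<noteq> 0"
  interpret prob_space "mu a" by (rule prob_mu)
  have xs: "{x} \<in> sets Bor" using pos emeasure_notin_sets[of "{x}" "mu a"] by (auto simp: sets_mu)
  have vim: "zd_shift (\<lambda>i. - g i) -` {x} \<inter> X = {zd_shift g x}" for g
    using x shift_in_X by (auto simp: zd_shift_inverse)
  have orb_sets: "{y} \<in> sets (mu a)" and orb_prob: "prob {y} = prob {x}"
    if y_orb: "y \<in> range (\<lambda>g. zd_shift g x)" for y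
  proof -
    obtain g where y: "y = zd_shift g x" using y_orb by (rule rangeE)
    show "{y} \<in> sets (mu a)"
      using shift_vimage_sets[OF xs, of "\<lambda>i. - g i"] by (simp add: vim y sets_mu)
    have "emeasure (mu a) (zd_shift (\<lambda>i. - g i) -` {x} \<inter> X) = emeasure (mu a) {x}"
      using invariant_mu xs by (simp add: shift_invariant_measure_def sets_mu)
    then show "prob {y} = prob {x}" by (simp add: vim y measure_def)
  qed
  have p: "0 < prob {x}" using pos by (simp add: emeasure_eq_measure zero_less_measure_iff)
  \<comment> \<open>All points of the orbit have the same positive mass, so only finitely many fit
    into total mass 1.\<close>
  have fin: "finite (range (\<lambda>g. zd_shift g x))"
  proof (rule ccontr)
    assume inf: "infinite (range (\<lambda>g. zd_shift g x))"
    obtain k :: nat where k: "1 < real k * prob {x}" using p by (metis reals_Archimedean3)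
    obtain F where F: "F \<subseteq> range (\<lambda>g. zd_shift g x)" "finite F" "card F = k"
      using infinite_arbitrarily_large[OF inf] by blast
    have "prob F = (\<Sum>y\<in>F. prob {y})"
      using F orb_sets by (intro finite_measure_eq_sum_singleton) auto
    also have "\<dots> = (\<Sum>y\<in>F. prob {x})" using F(1) orb_prob by (intro sum.cong) auto
    finally show False using k F(3) prob_le_1[of F] by simp
  qed
  have "emeasure Om (coding a -` {x} \<inter> space Om) \<noteq> 0" using pos emeasure_mu[OF xs] by simp
  \<comment> \<open>The preimage of the atom is not a null set, so it meets the almost sure event
    that the digits are eventually good.\<close>
  then obtain \<omega> N where w: "\<omega> \<in> space Om" "coding a \<omega> = x" "\<forall>n\<ge>N. \<omega> n \<in> good n"
  proof -
    have "\<exists>\<omega>\<in>coding a -` {x} \<inter> space Om. \<exists>N. \<forall>n\<ge>N. \<omega> n \<in> good n"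
    proof (rule ccontr)
      assume "\<not> ?thesis"
      then have "\<forall>\<omega>\<in>coding a -` {x} \<inter> space Om. \<not> (\<exists>N. \<forall>n\<ge>N. \<omega> n \<in> good n)"
        by simp
      then have "AE \<omega> in Om. (\<exists>N. \<forall>n\<ge>N. \<omega> n \<in> good n) \<longrightarrow> \<omega> \<notin> coding a -` {x} \<inter> space Om"
        by (intro AE_I2) blast
      with AE_good have "AE \<omega> in Om. \<omega> \<notin> coding a -` {x} \<inter> space Om"
        by (rule AE_mp)
      then have "emeasure Om (coding a -` {x} \<inter> space Om) = 0"
        by (subst (asm) AE_iff_measurable[OF measurable_sets[OF coding_measurable xs]]) auto
      then show False using \<open>emeasure Om (coding a -` {x} \<inter> space Om) \<noteq> 0\<close> by simp
    qed
    then show ?thesis using that by auto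
  qed
  have xw: "x = coding0 a \<omega>" using coding0_in_X[of \<omega> N a] w a by (auto simp: coding_def)
  obtain u0 where u0: "x u0 = 1" using coding0_one[of \<omega> N a] w a xw by auto
  \<comment> \<open>A finite orbit of nonzero points is incompatible with arbitrarily large windows of zeros.\<close>
  have nz: "\<exists>u. y u \<noteq> 0" if y_orb: "y \<in> range (\<lambda>g. zd_shift g x)" for y
  proof -
    obtain g where "y = zd_shift g x" using y_orb by (rule rangeE)
    then have "y (u0 \<boxminus> g) = 1" using u0 by (simp add: zd_shift_eq)
    then show ?thesis by (intro exI[of _ "u0 \<boxminus> g"]) simp
  qed
  define e where "e y = (SOME u. y u \<noteq> 0)" for y :: "('n \<Rightarrow> int) \<Rightarrow> nat"
  have e: "y (e y) \<noteq> 0" if "y \<in> range (\<lambda>g. zd_shift g x)" for y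
    unfolding e_def using nz[OF that] by (rule someI_ex)
  obtain R where R: "e ` range (\<lambda>g. zd_shift g x) \<subseteq> window R"
    using finite_subset_window[OF finite_imageI[OF fin]] by blast
  obtain v where v: "\<forall>u\<in>window R. x (u \<boxplus> v) = 0"
    using coding0_zero_window[of \<omega> N a R] w a xw by auto
  have "zd_shift v x (e (zd_shift v x)) = 0"
  proof -
    have "e (zd_shift v x) \<in> window R" using R by blast
    then show ?thesis using v by (simp add: zd_shift_eq)
  qed
  then show False using e[of "zd_shift v x"] by simp
qed

end

theorem theorem1p2:
  fixes d :: nat
  assumes "CARD('n::finite) = d" and "d \<ge> 1"
  shows "\<exists>X :: (('n \<Rightarrow> int) \<Rightarrow> nat) set.
           subshift X \<and> chaotic_almost_minimal X \<and>
           (\<exists>M1 M2. M1 \<noteq> M2 \<and>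
              ergodic_measure X M1 \<and> nonatomic_measure M1 \<and>
              ergodic_measure X M2 \<and> nonatomic_measure M2)"
proof -
  \<comment> \<open>The smallest growth allowed: the locale bound holds with equality.\<close>
  interpret block_scheme "\<lambda>n. int CARD('n) * (2 * int n + 10) * 2 ^ (n + 3)" "TYPE('n)"
    by unfold_locales simp
  show ?thesis
    using subshift_X cam_X mu_neq ergodic_mu nonatomic_mu[of 0] nonatomic_mu[of 1]
    by (intro exI[of _ X] conjI exI[of _ "mu 0"] exI[of _ "mu 1"]) auto
qed

end
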